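(* Assume the OMv conjecture. Then for every constant $\epsilon>0$ there does not exist a fully retroactive priority queue with key increments having $O(n^{1-\epsilon})$ update and query time subject to $\textsf{insert-key}(k)$, $\textsf{increase-key}(k)$ and $\textsf{find-max}(t)$.
   Context: A fully retroactive data structure maintains a sequence of updates, each with a distinct real time, modified by retroactive operations that create an update at a given time or cancel an existing update; a query at time $t$ is answered on the state obtained by applying, in time order, the updates with time at most $t$. Here the updates are $\textsf{insert-key}(k)$ (insert a key $k$ into the priority queue) and $\textsf{increase-key}(k)$ (increase the value of key $k$ in the queue by $1$), and the query $\textsf{find-max}(t)$ returns the maximum key value at time $t$. The parameter $n$ is the number of keys in the priority queue. OMv problem: given an $n\times n$ Boolean matrix $M$, then $n$ Boolean vectors $v_1,\dots,v_n$ arriving online, output the Boolean product $Mv_i$ before $v_{i+1}$ is revealed. OMv conjecture: for every constant $\epsilon>0$ no algorithm solves OMv in $O(n^{3-\epsilon})$ time. *)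

theory Defs
  imports Complex_Main "HOL-Library.Landau_Symbols" "HOL-Library.Discrete_Functions"
begin

section \<open>A deterministic word RAM\<close>

text \<open>
  Words have \<open>w\<close> bits and are represented by natural numbers below \<open>2 ^ w\<close>.  The word size has to
  be bounded: over integers of unbounded size with unit cost, a whole Boolean column fits into one
  number and OMv becomes easy.  A program mentions finitely many registers and finitely many
  arrays, both named by natural numbers; every array is indexed by words.
\<close>

datatype binop =
  Add | Sub | Mul | Div | Mod | Bit_and | Bit_or | Bit_xor | Shift_left | Shift_right | Less | Equal

datatype com =
    Skip
  | Const nat nat             \<comment> \<open>\<open>Const x k\<close>: \<open>x := k\<close>\<close>
  | Word_size nat             \<comment> \<open>\<open>Word_size x\<close>: \<open>x := w\<close>\<close>
  | Calc binop nat nat nat    \<comment> \<open>\<open>Calc f x y z\<close>: \<open>x := f y z\<close>\<close>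
  | Load nat nat nat          \<comment> \<open>\<open>Load x a y\<close>: \<open>x := a[y]\<close>\<close>
  | Store nat nat nat         \<comment> \<open>\<open>Store a x y\<close>: \<open>a[x] := y\<close>\<close>
  | Seq com com
  | If_nonzero nat com com
  | While_nonzero nat com

record memory =
  reg :: "nat \<Rightarrow> nat"
  arr :: "nat \<Rightarrow> nat \<Rightarrow> nat"

definition zero_memory :: memory where
  "zero_memory = \<lparr>reg = (\<lambda>_. 0), arr = (\<lambda>_ _. 0)\<rparr>"

definition set_reg :: "nat \<Rightarrow> nat \<Rightarrow> memory \<Rightarrow> memory" where
  "set_reg x v s = s\<lparr>reg := (reg s)(x := v)\<rparr>"

definition set_arr :: "nat \<Rightarrow> (nat \<Rightarrow> nat) \<Rightarrow> memory \<Rightarrow> memory" where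
  "set_arr a f s = s\<lparr>arr := (arr s)(a := f)\<rparr>"

fun calc :: "nat \<Rightarrow> binop \<Rightarrow> nat \<Rightarrow> nat \<Rightarrow> nat" where
  "calc w Add a b = (a + b) mod 2 ^ w"
| "calc w Sub a b = (a + (2 ^ w - b)) mod 2 ^ w"
| "calc w Mul a b = (a * b) mod 2 ^ w"
| "calc w Div a b = (a div b) mod 2 ^ w"
| "calc w Mod a b = (a mod b) mod 2 ^ w"
| "calc w Bit_and a b = (and a b) mod 2 ^ w"
| "calc w Bit_or a b = (or a b) mod 2 ^ w"
| "calc w Bit_xor a b = (xor a b) mod 2 ^ w"
| "calc w Shift_left a b = push_bit b a mod 2 ^ w"
| "calc w Shift_right a b = drop_bit b a mod 2 ^ w"
| "calc w Less a b = of_bool (a < b) mod 2 ^ w"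
| "calc w Equal a b = of_bool (a = b) mod 2 ^ w"

text \<open>
  \<open>exec w c s k s'\<close>: on a machine with \<open>w\<close>-bit words, \<open>c\<close> started in \<open>s\<close> terminates in \<open>s'\<close> after
  \<open>k\<close> steps.  Every instruction and every evaluation of a branch condition takes one step.
\<close>

inductive exec :: "nat \<Rightarrow> com \<Rightarrow> memory \<Rightarrow> nat \<Rightarrow> memory \<Rightarrow> bool" for w :: nat where
  exec_Skip: "exec w Skip s 1 s"
| exec_Const: "exec w (Const x k) s 1 (set_reg x (k mod 2 ^ w) s)"
| exec_Word_size: "exec w (Word_size x) s 1 (set_reg x (w mod 2 ^ w) s)"
| exec_Calc: "exec w (Calc f x y z) s 1 (set_reg x (calc w f (reg s y) (reg s z)) s)"
| exec_Load: "exec w (Load x a y) s 1 (set_reg x (arr s a (reg s y)) s)"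
| exec_Store: "exec w (Store a x y) s 1 (set_arr a ((arr s a)(reg s x := reg s y)) s)"
| exec_Seq: "exec w c1 s k s' \<Longrightarrow> exec w c2 s' k' s'' \<Longrightarrow> exec w (Seq c1 c2) s (k + k') s''"
| exec_If_true: "reg s x \<noteq> 0 \<Longrightarrow> exec w c1 s k s' \<Longrightarrow> exec w (If_nonzero x c1 c2) s (k + 1) s'"
| exec_If_false: "reg s x = 0 \<Longrightarrow> exec w c2 s k s' \<Longrightarrow> exec w (If_nonzero x c1 c2) s (k + 1) s'"
| exec_While_false: "reg s x = 0 \<Longrightarrow> exec w (While_nonzero x c) s 1 s"
| exec_While_true: "reg s x \<noteq> 0 \<Longrightarrow> exec w c s k s' \<Longrightarrow> exec w (While_nonzero x c) s' k' s''
    \<Longrightarrow> exec w (While_nonzero x c) s (k + k' + 1) s''"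

text \<open>
  The usual word size \<open>\<Theta>(log n)\<close>: a constant multiple \<open>c\<close> of the number of binary digits of \<open>n\<close>.
  In particular \<open>(n + 1) ^ d \<le> 2 ^ word_length c n\<close> whenever \<open>d \<le> c\<close>.
\<close>

definition word_length :: "nat \<Rightarrow> nat \<Rightarrow> nat" where
  "word_length c n = c * (floor_log n + 1)"


section \<open>Online Boolean matrix-vector multiplication\<close>

definition bool_mult_vec :: "nat \<Rightarrow> (nat \<Rightarrow> nat \<Rightarrow> bool) \<Rightarrow> (nat \<Rightarrow> bool) \<Rightarrow> nat \<Rightarrow> bool" where
  "bool_mult_vec n M v i \<longleftrightarrow> (\<exists>j<n. M i j \<and> v j)"

text \<open>Input: \<open>n\<close> in register 0, the matrix in row-major order in array 0.\<close>

definition omv_start :: "nat \<Rightarrow> (nat \<Rightarrow> nat \<Rightarrow> bool) \<Rightarrow> memory" where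
  "omv_start n M = set_reg 0 n (set_arr 0
     (\<lambda>p. if p < n * n then of_bool (M (p div n) (p mod n)) else 0) zero_memory)"

text \<open>A vector is revealed by writing it to the first \<open>n\<close> cells of array 1.\<close>

definition reveal :: "nat \<Rightarrow> (nat \<Rightarrow> bool) \<Rightarrow> memory \<Rightarrow> memory" where
  "reveal n v s = set_arr 1 (\<lambda>j. if j < n then of_bool (v j) else arr s 1 j) s"

text \<open>
  The program \<open>step\<close> runs once for every vector, and only afterwards is the next vector revealed.
  It has to leave the product in array 2; the memory persists from one run to the next.  The last
  argument bounds the total number of steps.
\<close>

primrec omv_answers ::
  "com \<Rightarrow> nat \<Rightarrow> nat \<Rightarrow> (nat \<Rightarrow> nat \<Rightarrow> bool) \<Rightarrow> (nat \<Rightarrow> bool) list \<Rightarrow> memory \<Rightarrow> nat \<Rightarrow> bool" where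
  "omv_answers step w n M [] s b \<longleftrightarrow> True"
| "omv_answers step w n M (v # vs) s b \<longleftrightarrow>
     (\<exists>k s'. exec w step (reveal n v s) k s' \<and> k \<le> b
        \<and> (\<forall>i<n. arr s' 2 i = of_bool (bool_mult_vec n M v i))
        \<and> omv_answers step w n M vs s' (b - k))"

text \<open>
  An online algorithm consists of a program \<open>pre\<close> that processes the matrix, and the program
  \<open>step\<close>.  The bound \<open>T n\<close> is on the total time, including \<open>pre\<close>.
\<close>

definition solves_omv :: "com \<Rightarrow> com \<Rightarrow> nat \<Rightarrow> (nat \<Rightarrow> nat) \<Rightarrow> bool" where
  "solves_omv pre step c T \<longleftrightarrow>
     (\<forall>n M vs. length vs = n \<longrightarrow>
        (\<exists>k s. exec (word_length c n) pre (omv_start n M) k s \<and> k \<le> T n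
           \<and> omv_answers step (word_length c n) n M vs s (T n - k)))"

text \<open>The condition \<open>2 \<le> c\<close> says that the positions of an \<open>n \<times> n\<close> matrix fit into words.\<close>

definition OMv_conjecture :: bool where
  "OMv_conjecture \<longleftrightarrow>
     (\<forall>\<epsilon>::real. \<epsilon> > 0 \<longrightarrow>
        \<not> (\<exists>pre step c T. 2 \<le> c \<and> solves_omv pre step c T
              \<and> (\<lambda>n. real (T n)) \<in> O(\<lambda>n. real n powr (3 - \<epsilon>))))"


section \<open>Fully retroactive priority queues with key increments\<close>

datatype update = Insert_key nat | Increase_key nat

text \<open>A queue maps the keys it contains to their values.  A key \<open>k\<close> enters with value \<open>iv k\<close>;
  the cases of interest are \<open>iv k = 0\<close> (keys are mere names) and \<open>iv k = k\<close> (keys are initial values).\<close>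

type_synonym queue = "nat \<rightharpoonup> nat"

fun apply_update :: "(nat \<Rightarrow> nat) \<Rightarrow> update \<Rightarrow> queue \<Rightarrow> queue" where
  "apply_update iv (Insert_key k) Q = Q(k \<mapsto> iv k)"
| "apply_update iv (Increase_key k) Q = (case Q k of None \<Rightarrow> Q | Some v \<Rightarrow> Q(k \<mapsto> v + 1))"

text \<open>The update sequence: at most one update for every real time.\<close>

type_synonym history = "real \<rightharpoonup> update"

definition replay :: "(nat \<Rightarrow> nat) \<Rightarrow> history \<Rightarrow> real set \<Rightarrow> queue" where
  "replay iv S A =
     fold (\<lambda>t. apply_update iv (the (S t))) (sorted_list_of_set (dom S \<inter> A)) Map.empty"

definition queue_at :: "(nat \<Rightarrow> nat) \<Rightarrow> history \<Rightarrow> real \<Rightarrow> queue" where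
  "queue_at iv S t = replay iv S {..t}"

definition find_max :: "(nat \<Rightarrow> nat) \<Rightarrow> history \<Rightarrow> real \<Rightarrow> nat" where
  "find_max iv S t = Max (ran (queue_at iv S t))"

definition num_keys :: "(nat \<Rightarrow> nat) \<Rightarrow> history \<Rightarrow> nat" where
  "num_keys iv S = card (dom (replay iv S UNIV))"

text \<open>Only absent keys are inserted, and only present keys are increased.\<close>

definition consistent :: "(nat \<Rightarrow> nat) \<Rightarrow> history \<Rightarrow> bool" where
  "consistent iv S \<longleftrightarrow>
     (\<forall>t k. (S t = Some (Insert_key k) \<longrightarrow> k \<notin> dom (replay iv S {..<t}))
          \<and> (S t = Some (Increase_key k) \<longrightarrow> k \<in> dom (replay iv S {..<t})))"

datatype operation = Create real update | Cancel real | Find_max real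

fun apply_operation :: "operation \<Rightarrow> history \<Rightarrow> history" where
  "apply_operation (Create t u) S = S(t \<mapsto> u)"
| "apply_operation (Cancel t) S = S(t := None)"
| "apply_operation (Find_max t) S = S"

fun legal_operation :: "(nat \<Rightarrow> nat) \<Rightarrow> history \<Rightarrow> operation \<Rightarrow> bool" where
  "legal_operation iv S (Create t u) \<longleftrightarrow> t \<notin> dom S \<and> consistent iv (S(t \<mapsto> u))"
| "legal_operation iv S (Cancel t) \<longleftrightarrow> t \<in> dom S \<and> consistent iv (S(t := None))"
| "legal_operation iv S (Find_max t) \<longleftrightarrow> queue_at iv S t \<noteq> Map.empty"

text \<open>Legal operation sequences during which the queue never has more than \<open>n\<close> keys.\<close>

primrec legal :: "(nat \<Rightarrow> nat) \<Rightarrow> nat \<Rightarrow> history \<Rightarrow> operation list \<Rightarrow> bool" where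
  "legal iv n S [] \<longleftrightarrow> True"
| "legal iv n S (x # xs) \<longleftrightarrow> legal_operation iv S x \<and> num_keys iv (apply_operation x S) \<le> n
     \<and> legal iv n (apply_operation x S) xs"

fun time_of :: "operation \<Rightarrow> real" where
  "time_of (Create t u) = t"
| "time_of (Cancel t) = t"
| "time_of (Find_max t) = t"

fun key_of :: "update \<Rightarrow> nat" where
  "key_of (Insert_key k) = k"
| "key_of (Increase_key k) = k"

text \<open>
  Arguments are passed to a data structure as words, so the times that occur are naturals.  A
  structure for arbitrary real times in particular has to handle these.
\<close>

fun operation_below :: "nat \<Rightarrow> operation \<Rightarrow> bool" where
  "operation_below b (Create t u) \<longleftrightarrow> t \<in> real ` {..<b} \<and> key_of u < b"
| "operation_below b (Cancel t) \<longleftrightarrow> t \<in> real ` {..<b}"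
| "operation_below b (Find_max t) \<longleftrightarrow> t \<in> real ` {..<b}"

record retroactive_queue =
  create_insert :: com
  create_increase :: com
  cancel :: com
  query :: com

fun program :: "retroactive_queue \<Rightarrow> operation \<Rightarrow> com" where
  "program D (Create t (Insert_key k)) = create_insert D"
| "program D (Create t (Increase_key k)) = create_increase D"
| "program D (Cancel t) = cancel D"
| "program D (Find_max t) = query D"

text \<open>Calling convention: \<open>n\<close>, the time and the key are passed in registers 0, 1 and 2.\<close>

fun pass_arguments :: "nat \<Rightarrow> operation \<Rightarrow> memory \<Rightarrow> memory" where
  "pass_arguments n (Create t u) s =
     set_reg 2 (key_of u) (set_reg 1 (nat \<lfloor>t\<rfloor>) (set_reg 0 n s))"
| "pass_arguments n (Cancel t) s = set_reg 1 (nat \<lfloor>t\<rfloor>) (set_reg 0 n s)"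
| "pass_arguments n (Find_max t) s = set_reg 1 (nat \<lfloor>t\<rfloor>) (set_reg 0 n s)"

text \<open>
  Every operation takes at most \<open>b\<close> steps, and every query returns the right answer in register 0.
  The memory persists between operations.
\<close>

primrec serves ::
  "(nat \<Rightarrow> nat) \<Rightarrow> retroactive_queue \<Rightarrow> nat \<Rightarrow> nat \<Rightarrow> nat \<Rightarrow> history \<Rightarrow> memory \<Rightarrow> operation list \<Rightarrow> bool"
where
  "serves iv D w n b S s [] \<longleftrightarrow> True"
| "serves iv D w n b S s (x # xs) \<longleftrightarrow>
     (\<exists>k s'. exec w (program D x) (pass_arguments n x s) k s' \<and> k \<le> b
        \<and> (\<forall>t. x = Find_max t \<longrightarrow> reg s' 0 = find_max iv S t)
        \<and> serves iv D w n b (apply_operation x S) s' xs)"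

text \<open>
  The structure starts empty.  The parameter \<open>n\<close> bounds the number of keys, while the number of
  operations, the times and the keys may be bounded by any polynomial \<open>(n + 1) ^ d\<close> in \<open>n\<close>; the
  constant factor of the word size and the constant of the time bound may depend on \<open>d\<close>.  By
  \<open>d < c\<close>, the arguments and the answers fit into words.  Without
  some bound on the number of operations in terms of \<open>n\<close>, no time bound depending on \<open>n\<close> alone would
  be achievable: for a single key the problem is dynamic prefix counting.
\<close>

definition fully_retroactive_queue ::
  "(nat \<Rightarrow> nat) \<Rightarrow> retroactive_queue \<Rightarrow> (nat \<Rightarrow> real) \<Rightarrow> bool" where
  "fully_retroactive_queue iv D g \<longleftrightarrow>
     (\<forall>d. \<exists>c T. d < c \<and> (\<lambda>n. real (T n)) \<in> O(g) \<and>
        (\<forall>n xs. legal iv n Map.empty xs \<longrightarrow> length xs \<le> (n + 1) ^ d \<longrightarrow>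
           (\<forall>x\<in>set xs. operation_below ((n + 1) ^ d) x) \<longrightarrow>
           serves iv D (word_length c n) n (T n) Map.empty zero_memory xs))"

end

theory Submission
  imports Defs
begin

text \<open>
  The keys are the columns of the matrix.  Before the query time of row \<open>i\<close>, key \<open>j\<close> has been
  increased up to the value \<open>n + i + M i j + v j\<close>, so the maximum at that time is
  \<open>n + i + 2\<close> if and only if some \<open>j\<close> has \<open>M i j\<close> and \<open>v j\<close>.  The increments for \<open>M\<close> depend only on
  the matrix; those for \<open>v\<close> lie before all rows and are created retroactively when \<open>v\<close> is
  revealed and cancelled after the \<open>n\<close> queries.  This takes \<open>O(n\<^sup>2)\<close> operations in total.

  The programs of the queue are relocated to registers and arrays of their own and called from
  loops that solve OMv.
\<close>

section \<open>Programs inside a larger memory\<close>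

text \<open>A query reveals one number, the maximum, so a conjunction has to be read off a sum of
  two bits. This needs an offset common to all keys whenever a row is queried, and that requirement
  shapes the construction. Initial values may differ (\<open>iv k = k\<close>), hence the lifting of
  every key to \<open>n\<close>. There is no decrement, so the bits of a row cannot be removed after
  its query: instead every key receives exactly one increment per row, before the query if the entry
  is 1 and after it if the entry is 0, and up to the bits of \<open>v\<close> all keys agree again
  before the next row. One increment at the beginning of time shifts a key at all \<open>n\<close>
  query times at once; this is what retroactivity buys, as a vector then costs O(n) operations.

  A second obstacle: the specification of the queue speaks of a complete list of operations, whereas
  here later operations depend on vectors that are not yet revealed. The predicate
  \<open>ready\<close> therefore quantifies over all continuations.\<close>

lemma exec_deterministic:
  "exec w c s k s' \<Longrightarrow> exec w c s k' s'' \<Longrightarrow> k' = k \<and> s'' = s'"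
proof (induction arbitrary: k' s'' rule: exec.induct)
  case (exec_Seq c1 s k1 s1 c2 k2 s2)
  from exec_Seq.prems show ?case
  proof (cases rule: exec.cases)
    case (exec_Seq k s' k')
    with exec_Seq.IH show ?thesis by blast
  qed
next
  case (exec_If_true s x c1 k s1 c2)
  from exec_If_true.prems show ?case
  proof (cases rule: exec.cases)
    case (exec_If_true k)
    with exec_If_true.IH show ?thesis by blast
  next
    case (exec_If_false k)
    with exec_If_true.hyps show ?thesis by simp
  qed
next
  case (exec_If_false s x c2 k s1 c1)
  from exec_If_false.prems show ?case
  proof (cases rule: exec.cases)
    case (exec_If_true k)
    with exec_If_false.hyps show ?thesis by simp
  next
    case (exec_If_false k)
    with exec_If_false.IH show ?thesis by blast
  qed
next
  case (exec_While_false s x c)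
  from exec_While_false.prems show ?case
  proof (cases rule: exec.cases)
    case (exec_While_true k s' k')
    with exec_While_false.hyps show ?thesis by simp
  qed simp
next
  case (exec_While_true s x c k1 s1 k2 s2)
  from exec_While_true.prems show ?case
  proof (cases rule: exec.cases)
    case exec_While_false
    with exec_While_true.hyps show ?thesis by simp
  next
    case (exec_While_true k s' k')
    with exec_While_true.IH show ?thesis by blast
  qed
qed (erule exec.cases; simp; fail)+

text \<open>
  \<open>join s m\<close> keeps \<open>s\<close> in the registers below 12 and the arrays below 3, which include the ones
  fixed by the OMv calling convention, and places \<open>m\<close> behind them.
\<close>

definition join :: "memory \<Rightarrow> memory \<Rightarrow> memory" where
  "join s m = \<lparr>reg = (\<lambda>r. if r < 12 then reg s r else reg m (r - 12)),
               arr = (\<lambda>a. if a < 3 then arr s a else arr m (a - 3))\<rparr>"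

lemma reg_join [simp]: "r < 12 \<Longrightarrow> reg (join s m) r = reg s r" "reg (join s m) (r + 12) = reg m r"
  and arr_join [simp]: "a < 3 \<Longrightarrow> arr (join s m) a = arr s a" "arr (join s m) (a + 3) = arr m a"
  by (simp_all add: join_def)

lemma set_reg_join [simp]:
  "r < 12 \<Longrightarrow> set_reg r v (join s m) = join (set_reg r v s) m"
  "set_reg (r + 12) v (join s m) = join s (set_reg r v m)"
  by (auto simp: join_def set_reg_def fun_eq_iff)

lemma set_arr_join [simp]:
  "a < 3 \<Longrightarrow> set_arr a f (join s m) = join (set_arr a f s) m"
  "set_arr (a + 3) f (join s m) = join s (set_arr a f m)"
  by (auto simp: join_def set_arr_def fun_eq_iff)

lemma reg_set_reg [simp]: "reg (set_reg x v s) = (reg s)(x := v)"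
  and arr_set_reg [simp]: "arr (set_reg x v s) = arr s"
  and reg_set_arr [simp]: "reg (set_arr a f s) = reg s"
  and arr_set_arr [simp]: "arr (set_arr a f s) = (arr s)(a := f)"
  by (simp_all add: set_reg_def set_arr_def)

lemma reveal_join: "reveal n v (join s m) = join (reveal n v s) m"
  by (simp add: reveal_def cong: if_cong)

text \<open>Everything outside the input is 0, so the queue finds its required initial memory in
  place and no set-up code is needed.\<close>

lemma omv_start_join: "omv_start n M = join (omv_start n M) zero_memory"
  by (auto simp: omv_start_def join_def set_reg_def set_arr_def zero_memory_def)

primrec relocate :: "com \<Rightarrow> com" where
  "relocate Skip = Skip"
| "relocate (Const x k) = Const (x + 12) k"
| "relocate (Word_size x) = Word_size (x + 12)"
| "relocate (Calc f x y z) = Calc f (x + 12) (y + 12) (z + 12)"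
| "relocate (Load x a y) = Load (x + 12) (a + 3) (y + 12)"
| "relocate (Store a x y) = Store (a + 3) (x + 12) (y + 12)"
| "relocate (Seq c d) = Seq (relocate c) (relocate d)"
| "relocate (If_nonzero x c d) = If_nonzero (x + 12) (relocate c) (relocate d)"
| "relocate (While_nonzero x c) = While_nonzero (x + 12) (relocate c)"

text \<open>Relocated code reads, writes and branches on shifted names only. The number of steps is
  unchanged, so the time bound of the queue carries over.\<close>

lemma exec_relocate:
  "exec w c m k m' \<Longrightarrow> exec w (relocate c) (join s m) k (join s m')"
proof (induction rule: exec.induct)
  case (exec_Skip m)
  show ?case using exec.exec_Skip by simp
next
  case (exec_Const x k m)
  show ?case using exec.exec_Const[of w "x + 12" k "join s m"] by simp
next
  case (exec_Word_size x m)
  show ?case using exec.exec_Word_size[of w "x + 12" "join s m"] by simp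
next
  case (exec_Calc f x y z m)
  show ?case using exec.exec_Calc[of w f "x + 12" "y + 12" "z + 12" "join s m"] by simp
next
  case (exec_Load x a y m)
  show ?case using exec.exec_Load[of w "x + 12" "a + 3" "y + 12" "join s m"] by simp
next
  case (exec_Store a x y m)
  show ?case using exec.exec_Store[of w "a + 3" "x + 12" "y + 12" "join s m"] by simp
next
  case (exec_If_true m x c1 k m' c2)
  then show ?case using exec.exec_If_true[of "join s m" "x + 12"] by simp
next
  case (exec_If_false m x c2 k m' c1)
  then show ?case using exec.exec_If_false[of "join s m" "x + 12"] by simp
next
  case (exec_While_false m x c)
  then show ?case using exec.exec_While_false[of "join s m" "x + 12"] by simp
next
  case (exec_While_true m x c k m' k' m'')
  then show ?case using exec.exec_While_true[of "join s m" "x + 12"] by simp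
next
  case (exec_Seq c1 m k m' c2 k' m'')
  then show ?case using exec.exec_Seq by simp
qed

text \<open>The single instructions that the reduction executes on its own part of the memory. Their
  result is given by the function \<open>effect\<close>, so that simplification can evaluate
  straight-line code.\<close>

fun own :: "com \<Rightarrow> bool" where
  "own (Const x k) \<longleftrightarrow> x < 12"
| "own (Calc f x y z) \<longleftrightarrow> x < 12 \<and> y < 12 \<and> z < 12"
| "own (Load x a y) \<longleftrightarrow> x < 12 \<and> a < 3 \<and> y < 12"
| "own (Store a x y) \<longleftrightarrow> a < 3 \<and> x < 12 \<and> y < 12"
| "own _ \<longleftrightarrow> False"

fun effect :: "nat \<Rightarrow> com \<Rightarrow> memory \<Rightarrow> memory" where
  "effect w (Const x k) s = set_reg x (k mod 2 ^ w) s"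
| "effect w (Calc f x y z) s = set_reg x (calc w f (reg s y) (reg s z)) s"
| "effect w (Load x a y) s = set_reg x (arr s a (reg s y)) s"
| "effect w (Store a x y) s = set_arr a ((arr s a)(reg s x := reg s y)) s"
| "effect w _ s = s"

lemma exec_own: "own c \<Longrightarrow> exec w c (join s m) 1 (join (effect w c s) m)"
proof (induction c rule: own.induct)
  case (1 x k)
  then show ?case using exec.exec_Const[of w x k "join s m"] by simp
next
  case (2 f x y z)
  then show ?case using exec.exec_Calc[of w f x y z "join s m"] by simp
next
  case (3 x a y)
  then show ?case using exec.exec_Load[of w x a y "join s m"] by simp
next
  case (4 a x y)
  then show ?case using exec.exec_Store[of w a x y "join s m"] by simp
qed auto


section \<open>Replaying well-formed histories\<close>

text \<open>A condition on the set of updates alone, with no reference to replaying. It implies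
  \<open>consistent\<close> and makes the state a matter of counting, since every increment takes
  effect.\<close>

definition well_formed :: "history \<Rightarrow> bool" where
  "well_formed S \<longleftrightarrow> finite (dom S)
     \<and> (\<forall>t t' k. S t = Some (Insert_key k) \<longrightarrow> S t' = Some (Insert_key k) \<longrightarrow> t = t')
     \<and> (\<forall>t k. S t = Some (Increase_key k) \<longrightarrow> (\<exists>t'<t. S t' = Some (Insert_key k)))"

lemma sorted_list_of_set_insert_max:
  fixes b :: "'a :: linorder"
  assumes "finite F" "\<forall>a\<in>F. a < b"
  shows "sorted_list_of_set (insert b F) = sorted_list_of_set F @ [b]"
proof (rule sorted_distinct_set_unique)
  show "sorted (sorted_list_of_set F @ [b])" "distinct (sorted_list_of_set F @ [b])"
    and "set (sorted_list_of_set (insert b F)) = set (sorted_list_of_set F @ [b])"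
    using assms by (auto simp: sorted_append less_imp_le simp del: sorted_list_of_set_insert_remove)
qed (simp_all del: sorted_list_of_set_insert_remove)

text \<open>Induction on \<open>F\<close>, adding the latest time \<open>b\<close>. If
  \<open>b\<close> increases a key, the insertion of that key is earlier and lies in
  \<open>F\<close> because \<open>F\<close> is closed downwards in \<open>dom S\<close>, so the
  increment is not lost. If \<open>b\<close> inserts a key, no increment of it occurs in
  \<open>F\<close>: it would need an insertion before \<open>b\<close>, and the insertion is
  unique.\<close>

lemma fold_well_formed:
  assumes S: "well_formed S" and "finite F" "F \<subseteq> dom S"
    and "\<forall>t\<in>F. \<forall>t'\<in>dom S. t' < t \<longrightarrow> t' \<in> F"
  shows "fold (\<lambda>t. apply_update iv (the (S t))) (sorted_list_of_set F) Map.empty =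
    (\<lambda>k. if \<exists>t\<in>F. S t = Some (Insert_key k)
          then Some (iv k + card {t\<in>F. S t = Some (Increase_key k)}) else None)"
  using assms(2-)
proof (induction F rule: finite_linorder_max_induct)
  case empty
  then show ?case by auto
next
  case (insert b F)
  let ?f = "\<lambda>F k. if \<exists>t\<in>F. S t = Some (Insert_key k)
          then Some (iv k + card {t\<in>F. S t = Some (Increase_key k)}) else None"
  have IH: "fold (\<lambda>t. apply_update iv (the (S t))) (sorted_list_of_set F) Map.empty = ?f F"
  proof (rule insert.IH)
    show "F \<subseteq> dom S" using insert.prems by blast
    show "\<forall>t\<in>F. \<forall>t'\<in>dom S. t' < t \<longrightarrow> t' \<in> F"
    proof (intro ballI impI)
      fix t t'
      assume t: "t \<in> F" "t' \<in> dom S" "t' < t"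
      then have "t' \<in> insert b F" using insert.prems by blast
      moreover have "t' \<noteq> b" using t insert.hyps by force
      ultimately show "t' \<in> F" by blast
    qed
  qed
  have "b \<notin> F" using insert.hyps by auto
  have cards: "card {t \<in> insert b F. S t = Some (Increase_key k)} =
    (if S b = Some (Increase_key k) then 1 else 0) + card {t \<in> F. S t = Some (Increase_key k)}" for k
  proof (cases "S b = Some (Increase_key k)")
    case True
    then have "{t \<in> insert b F. S t = Some (Increase_key k)} =
      insert b {t \<in> F. S t = Some (Increase_key k)}" by auto
    then show ?thesis using True \<open>b \<notin> F\<close> \<open>finite F\<close> by simp
  next
    case False
    then have "{t \<in> insert b F. S t = Some (Increase_key k)} =
      {t \<in> F. S t = Some (Increase_key k)}" by auto
    then show ?thesis using False by simp
  qed
  obtain u where u: "S b = Some u" using insert.prems by auto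
  have "apply_update iv u (?f F) = ?f (insert b F)"
  proof (cases u)
    case (Insert_key k)
    have "S t \<noteq> Some (Insert_key k)" if "t \<in> F" for t
      using S u Insert_key \<open>b \<notin> F\<close> that unfolding well_formed_def by blast
    moreover have "S t \<noteq> Some (Increase_key k)" if "t \<in> F" for t
    proof
      assume "S t = Some (Increase_key k)"
      then obtain t' where "t' < t" "S t' = Some (Insert_key k)"
        using S unfolding well_formed_def by blast
      moreover from this have "t' = b"
        using S u Insert_key unfolding well_formed_def by blast
      ultimately show False using insert.hyps(2) that by force
    qed
    ultimately have "{t \<in> F. S t = Some (Increase_key k)} = {}" by blast
    then have e: "card {t \<in> F. S t = Some (Increase_key k)} = 0" by (simp only: card.empty)
    show ?thesis
      unfolding Insert_key apply_update.simps cards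
      using u Insert_key e by (intro ext) auto
  next
    case (Increase_key k)
    then obtain t where t: "t < b" "S t = Some (Insert_key k)"
      using S u unfolding well_formed_def by blast
    then have "t \<in> F" using insert.prems by auto
    with t have ex: "\<exists>t\<in>F. S t = Some (Insert_key k)" by blast
    show ?thesis
      unfolding Increase_key apply_update.simps cards
      using u Increase_key ex by (intro ext) auto
  qed
  moreover have "fold (\<lambda>t. apply_update iv (the (S t))) (sorted_list_of_set (insert b F)) Map.empty =
    apply_update iv u (?f F)"
    unfolding sorted_list_of_set_insert_max[OF insert.hyps] fold_append
    by (simp only: IH u fold.simps comp_apply id_apply option.sel)
  ultimately show ?case by (simp only:)
qed

text \<open>Downward closed sets cover the three cases that occur: \<open>{..t}\<close> in
  \<open>queue_at\<close>, \<open>{..<t}\<close> in \<open>consistent\<close> and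
  \<open>UNIV\<close> in \<open>num_keys\<close>.\<close>

lemma replay_well_formed:
  assumes S: "well_formed S" and A: "\<forall>t\<in>A. \<forall>t'<t. t' \<in> A"
  shows "replay iv S A =
    (\<lambda>k. if \<exists>t\<in>A. S t = Some (Insert_key k)
          then Some (iv k + card {t\<in>A. S t = Some (Increase_key k)}) else None)"
proof -
  have *: "{t \<in> dom S \<inter> A. S t = Some u} = {t \<in> A. S t = Some u}" for u by auto
  have **: "(\<exists>t\<in>dom S \<inter> A. S t = Some u) \<longleftrightarrow> (\<exists>t\<in>A. S t = Some u)" for u by auto
  have "finite (dom S \<inter> A)" using S by (simp add: well_formed_def)
  moreover have "\<forall>t\<in>dom S \<inter> A. \<forall>t'\<in>dom S. t' < t \<longrightarrow> t' \<in> dom S \<inter> A"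
    using A by blast
  ultimately show ?thesis
    unfolding replay_def using fold_well_formed[OF S, of "dom S \<inter> A" iv] by (simp only: * ** Int_lower1)
qed

lemma dom_replay_well_formed:
  assumes "well_formed S" "\<forall>t\<in>A. \<forall>t'<t. t' \<in> A"
  shows "k \<in> dom (replay iv S A) \<longleftrightarrow> (\<exists>t\<in>A. S t = Some (Insert_key k))"
  by (simp only: dom_def replay_well_formed[OF assms] mem_Collect_eq) simp

lemma consistent_well_formed:
  assumes S: "well_formed S"
  shows "consistent iv S"
  unfolding consistent_def
proof (intro allI conjI impI)
  fix t k
  have dom: "k \<in> dom (replay iv S {..<t}) \<longleftrightarrow> (\<exists>t'\<in>{..<t}. S t' = Some (Insert_key k))"
    by (rule dom_replay_well_formed[OF S]) simp
  show "k \<notin> dom (replay iv S {..<t})" if "S t = Some (Insert_key k)"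
  proof
    assume "k \<in> dom (replay iv S {..<t})"
    then obtain t' where "t' < t" "S t' = Some (Insert_key k)" using dom by blast
    moreover from this have "t' = t" using S that unfolding well_formed_def by blast
    ultimately show False by simp
  qed
  show "k \<in> dom (replay iv S {..<t})" if "S t = Some (Increase_key k)"
    unfolding dom using S that unfolding well_formed_def by blast
qed


section \<open>Running programs on top of a retroactive queue\<close>

text \<open>A loop condition can only test a register against 0, so \<open>y\<close> caches the
  comparison of the counter \<open>x\<close> with the bound. Register 0 is expected to hold
  \<open>n\<close> and register 1 to hold 1.\<close>

definition for_loop :: "nat \<Rightarrow> nat \<Rightarrow> com \<Rightarrow> com" where
  "for_loop x y c = foldr Seq [Const x 0, Calc Less y x 0]
     (While_nonzero y (Seq c (foldr Seq [Calc Add x x 1] (Calc Less y x 0))))"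

text \<open>There is no move instruction; \<open>y OR y\<close> copies \<open>y\<close>.\<close>

definition create :: "com \<Rightarrow> nat \<Rightarrow> nat \<Rightarrow> com" where
  "create p x y = Seq (Calc Bit_or 12 0 0) (Seq (Calc Bit_or 13 x x) (Seq (Calc Bit_or 14 y y)
     (relocate p)))"

text \<open>Registers 12, 13 and 14 are the relocated argument registers 0, 1 and 2. Cancellations
  and queries have no key to pass; after a query, the answer is in register 12 again.\<close>

definition call :: "com \<Rightarrow> nat \<Rightarrow> com" where
  "call p x = Seq (Calc Bit_or 12 0 0) (Seq (Calc Bit_or 13 x x) (relocate p))"

definition ask :: "com \<Rightarrow> nat \<Rightarrow> nat \<Rightarrow> com" where
  "ask p x y = Seq (call p x) (Calc Bit_or y 12 12)"

text \<open>
  Of the witnesses of \<open>serves\<close>, those for the first operation do not depend on the later ones, since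
  \<open>exec\<close> is deterministic.  Hence a memory can be \<open>ready\<close> for all continuations at once.
\<close>

locale queue_machine =
  fixes iv :: "nat \<Rightarrow> nat" and D :: retroactive_queue and w n b B :: nat
  assumes n_pos: "0 < n"
    and fits: "16 * (n + 1)\<^sup>2 \<le> 2 ^ w"
    and times_below: "4 * (n + 1)\<^sup>2 \<le> B"
begin

text \<open>The guarantee for the queue covers operation lists of bounded length, so
  \<open>l\<close> counts the operations that are still available.\<close>

definition ready :: "history \<Rightarrow> memory \<Rightarrow> nat \<Rightarrow> bool" where
  "ready S m l \<longleftrightarrow> (\<forall>xs. legal iv n S xs \<longrightarrow> length xs \<le> l \<longrightarrow>
     (\<forall>x\<in>set xs. operation_below B x) \<longrightarrow> serves iv D w n b S m xs)"

lemma ready_mono: "ready S m l \<Longrightarrow> l' \<le> l \<Longrightarrow> ready S m l'"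
  by (auto simp: ready_def)

text \<open>The list \<open>[x]\<close> supplies the memory \<open>m'\<close>. A longer list
  \<open>x # xs\<close> supplies a memory of its own after \<open>x\<close>, but determinism
  identifies it with \<open>m'\<close>, which is thus good for every \<open>xs\<close>.\<close>

lemma ready_operation:
  assumes ready: "ready S m (Suc l)"
    and x: "legal_operation iv S x" "num_keys iv (apply_operation x S) \<le> n" "operation_below B x"
  obtains k m' where "exec w (program D x) (pass_arguments n x m) k m'" "k \<le> b"
    "\<And>t. x = Find_max t \<Longrightarrow> reg m' 0 = find_max iv S t"
    "ready (apply_operation x S) m' l"
proof -
  have "serves iv D w n b S m [x]"
    using ready x by (simp add: ready_def del: serves.simps)
  then obtain k m' where k: "exec w (program D x) (pass_arguments n x m) k m'" "k \<le> b"
    "\<forall>t. x = Find_max t \<longrightarrow> reg m' 0 = find_max iv S t"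
    by auto
  have "ready (apply_operation x S) m' l"
    unfolding ready_def
  proof (intro allI impI)
    fix xs
    assume "legal iv n (apply_operation x S) xs" "length xs \<le> l" "\<forall>x\<in>set xs. operation_below B x"
    then have "serves iv D w n b S m (x # xs)"
      using ready x by (simp add: ready_def del: serves.simps)
    then obtain k' m'' where "exec w (program D x) (pass_arguments n x m) k' m''"
      "serves iv D w n b (apply_operation x S) m'' xs"
      by auto
    moreover from this(1) have "m'' = m'" using exec_deterministic k(1) by blast
    ultimately show "serves iv D w n b (apply_operation x S) m' xs" by simp
  qed
  with k that show thesis by blast
qed

text \<open>
  The cost \<open>u\<close> bounds the number of queue operations, and also the running time if it is measured in
  units of \<open>b + 1\<close> steps.
\<close>

definition run :: "com \<Rightarrow> memory \<Rightarrow> history \<Rightarrow> nat \<Rightarrow> (memory \<Rightarrow> history \<Rightarrow> bool) \<Rightarrow> bool" where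
  "run c s S u Q \<longleftrightarrow> (\<forall>m l. ready S m (l + u) \<longrightarrow>
     (\<exists>k s' m' S'. exec w c (join s m) k (join s' m') \<and> k \<le> u * (b + 1) \<and> Q s' S' \<and> ready S' m' l))"

lemma runE:
  assumes "run c s S u Q" "ready S m (l + u)"
  obtains k s' m' S' where "exec w c (join s m) k (join s' m')" "k \<le> u * (b + 1)" "Q s' S'"
    "ready S' m' l"
  using assms unfolding run_def by blast

section \<open>Proof rules for \<open>run\<close>, in the style of Hoare logic\<close>

lemma run_mono:
  assumes "run c s S u Q" "u \<le> u'" "\<And>s' S'. Q s' S' \<Longrightarrow> Q' s' S'"
  shows "run c s S u' Q'"
  unfolding run_def
proof (intro allI impI)
  fix m l
  assume "ready S m (l + u')"
  then have "ready S m (l + u)" by (rule ready_mono) (use assms(2) in simp)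
  then obtain k s' m' S' where
    *: "exec w c (join s m) k (join s' m')" "k \<le> u * (b + 1)" "Q s' S'" "ready S' m' l"
    by (rule runE[OF assms(1)])
  moreover have "u * (b + 1) \<le> u' * (b + 1)" using assms(2) by (rule mult_le_mono1)
  ultimately show "\<exists>k s' m' S'. exec w c (join s m) k (join s' m') \<and> k \<le> u' * (b + 1)
      \<and> Q' s' S' \<and> ready S' m' l"
    using assms(3) le_trans by blast
qed

lemma run_Skip: "Q s S \<Longrightarrow> 1 \<le> u \<Longrightarrow> run Skip s S u Q"
proof (rule run_mono[where u = 1])
  assume Q: "Q s S"
  show "run Skip s S 1 Q"
    unfolding run_def
  proof (intro allI impI)
    fix m l
    assume "ready S m (l + 1)"
    then have "ready S m l" by (rule ready_mono) simp
    with Q exec_Skip[of w "join s m"] show "\<exists>k s' m' S'. exec w Skip (join s m) k (join s' m')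
      \<and> k \<le> 1 * (b + 1) \<and> Q s' S' \<and> ready S' m' l" by fastforce
  qed
qed

lemma run_own:
  assumes "own c" "Q (effect w c s) S"
  shows "run c s S 1 Q"
  unfolding run_def
proof (intro allI impI)
  fix m l
  assume "ready S m (l + 1)"
  then have "ready S m l" by (rule ready_mono) simp
  with assms exec_own[of c w s m] show "\<exists>k s' m' S'. exec w c (join s m) k (join s' m')
    \<and> k \<le> 1 * (b + 1) \<and> Q s' S' \<and> ready S' m' l" by fastforce
qed

text \<open>The postcondition of the first program is itself a \<open>run\<close> statement, so the
  intermediate state and history need no name. Of the available operations, \<open>u'\<close> remain
  for the second program.\<close>

lemma run_Seq:
  assumes "run c s S u (\<lambda>s' S'. run c' s' S' u' Q)"
  shows "run (Seq c c') s S (u + u') Q"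
  unfolding run_def
proof (intro allI impI)
  fix m l
  assume "ready S m (l + (u + u'))"
  then have "ready S m ((l + u') + u)" by (simp add: ac_simps)
  then obtain k s1 m1 S1 where 1: "exec w c (join s m) k (join s1 m1)" "k \<le> u * (b + 1)"
    "run c' s1 S1 u' Q" "ready S1 m1 (l + u')"
    by (rule runE[OF assms])
  from 1(3,4) obtain k' s2 m2 S2 where 2: "exec w c' (join s1 m1) k' (join s2 m2)"
    "k' \<le> u' * (b + 1)" "Q s2 S2" "ready S2 m2 l"
    by (rule runE)
  have "k + k' \<le> (u + u') * (b + 1)"
    using 1(2) 2(2) by (simp add: algebra_simps)
  with exec_Seq[OF 1(1) 2(1)] 2(3,4)
  show "\<exists>k s' m' S'. exec w (Seq c c') (join s m) k (join s' m')
    \<and> k \<le> (u + u') * (b + 1) \<and> Q s' S' \<and> ready S' m' l" by blast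
qed

lemma run_If:
  assumes "x < 12" "reg s x \<noteq> 0 \<Longrightarrow> run c s S u Q" "reg s x = 0 \<Longrightarrow> run c' s S u Q"
  shows "run (If_nonzero x c c') s S (u + 1) Q"
  unfolding run_def
proof (intro allI impI)
  fix m l
  assume "ready S m (l + (u + 1))"
  then have r: "ready S m (l + u)" by (rule ready_mono) simp
  let ?G = "\<exists>k s' m' S'. exec w (If_nonzero x c c') (join s m) k (join s' m')
    \<and> k \<le> (u + 1) * (b + 1) \<and> Q s' S' \<and> ready S' m' l"
  show ?G
  proof (cases "reg s x = 0")
    case False
    from runE[OF assms(2)[OF False] r] obtain k s' m' S' where
      *: "exec w c (join s m) k (join s' m')" "k \<le> u * (b + 1)" "Q s' S'" "ready S' m' l" .
    have "exec w (If_nonzero x c c') (join s m) (k + 1) (join s' m')"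
      using False assms(1) *(1) by (intro exec_If_true) auto
    moreover have "k + 1 \<le> (u + 1) * (b + 1)" using *(2) by simp
    ultimately show ?G using * by blast
  next
    case True
    from runE[OF assms(3)[OF True] r] obtain k s' m' S' where
      *: "exec w c' (join s m) k (join s' m')" "k \<le> u * (b + 1)" "Q s' S'" "ready S' m' l" .
    have "exec w (If_nonzero x c c') (join s m) (k + 1) (join s' m')"
      using True assms(1) *(1) by (intro exec_If_false) auto
    moreover have "k + 1 \<le> (u + 1) * (b + 1)" using *(2) by simp
    ultimately show ?G using * by blast
  qed
qed

text \<open>A block of own instructions becomes a \<open>fold\<close> of effects that simplification
  computes; the slack in \<open>u'\<close> absorbs the arithmetic of costs.\<close>

lemma run_straight:
  assumes "list_all own cs" "run c (fold (effect w) cs s) S u Q" "length cs + u \<le> u'"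
  shows "run (foldr Seq cs c) s S u' Q"
proof -
  have "run (foldr Seq cs c) s S (length cs + u) Q"
    using assms(1,2)
  proof (induction cs arbitrary: s)
    case (Cons a cs)
    then have "run a s S 1 (\<lambda>s' S'. run (foldr Seq cs c) s' S' (length cs + u) Q)"
      by (intro run_own) auto
    from run_Seq[OF this] show ?case by simp
  qed simp
  then show ?thesis by (rule run_mono) (use assms(3) in auto)
qed

lemma less_word: "k \<le> 4 * (n + 1)\<^sup>2 \<Longrightarrow> k < 2 ^ w"
proof -
  assume "k \<le> 4 * (n + 1)\<^sup>2"
  moreover have "0 < (n + 1)\<^sup>2" by simp
  ultimately show "k < 2 ^ w" using fits by linarith
qed

lemma small_word: "k \<le> 4 * n + 4 \<Longrightarrow> k < 2 ^ w"
  by (rule less_word) (simp add: power2_eq_square)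

lemma w_pos [simp]: "0 < w"
  using small_word[of 1] by (intro Nat.gr0I) simp

lemma one_word [simp]: "1 mod 2 ^ w = (1 :: nat)" "Suc 0 mod 2 ^ w = Suc 0"
  "of_bool P mod 2 ^ w = (of_bool P :: nat)"
proof -
  have "1 < (2 :: nat) ^ w" by (rule small_word) simp
  then show "1 mod 2 ^ w = (1 :: nat)" "Suc 0 mod 2 ^ w = Suc 0"
    "of_bool P mod 2 ^ w = (of_bool P :: nat)" by (cases P; simp del: one_less_power)+
qed

lemma run_while:
  assumes "run c s S u (\<lambda>s' S'. run (While_nonzero x c) s' S' u' Q)"
    and "x < 12" "reg s x \<noteq> 0"
  shows "run (While_nonzero x c) s S (u + u' + 1) Q"
  unfolding run_def
proof (intro allI impI)
  fix m l
  assume "ready S m (l + (u + u' + 1))"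
  then have "ready S m ((l + u') + u)" by (rule ready_mono) simp
  then obtain k s1 m1 S1 where 1: "exec w c (join s m) k (join s1 m1)" "k \<le> u * (b + 1)"
    "run (While_nonzero x c) s1 S1 u' Q" "ready S1 m1 (l + u')"
    by (rule runE[OF assms(1)])
  from 1(3,4) obtain k' s2 m2 S2 where 2: "exec w (While_nonzero x c) (join s1 m1) k' (join s2 m2)"
    "k' \<le> u' * (b + 1)" "Q s2 S2" "ready S2 m2 l"
    by (rule runE)
  have "k + k' + 1 \<le> (u + u' + 1) * (b + 1)"
    using 1(2) 2(2) by (simp add: algebra_simps)
  moreover have "exec w (While_nonzero x c) (join s m) (k + k' + 1) (join s2 m2)"
    using assms(2,3) by (intro exec_While_true[OF _ 1(1) 2(1)]) simp
  ultimately show "\<exists>k s' m' S'. exec w (While_nonzero x c) (join s m) k (join s' m')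
    \<and> k \<le> (u + u' + 1) * (b + 1) \<and> Q s' S' \<and> ready S' m' l" using 2(3,4) by blast
qed

lemma run_while_done:
  assumes "Q s S" "x < 12" "reg s x = 0"
  shows "run (While_nonzero x c) s S 1 Q"
  unfolding run_def
proof (intro allI impI)
  fix m l
  assume "ready S m (l + 1)"
  then have "ready S m l" by (rule ready_mono) simp
  moreover have "exec w (While_nonzero x c) (join s m) 1 (join s m)"
    using assms by (intro exec_While_false) simp
  ultimately show "\<exists>k s' m' S'. exec w (While_nonzero x c) (join s m) k (join s' m')
    \<and> k \<le> 1 * (b + 1) \<and> Q s' S' \<and> ready S' m' l" using assms(1) by fastforce
qed

text \<open>The body has to preserve the counter \<open>x\<close> but may leave anything in
  \<open>y\<close>, since the flag is recomputed after it. The 3 added to \<open>u\<close> pays for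
  the increment, the comparison and the test; the final 3 pays for the two initial instructions and
  the last test.\<close>

lemma run_for_loop:
  assumes body: "\<And>i s S. i < n \<Longrightarrow> I i s S \<Longrightarrow> reg s x = i \<Longrightarrow>
      run c s S u (\<lambda>s' S'. I (Suc i) s' S' \<and> reg s' x = i)"
    and regs: "\<And>i s S. I i s S \<Longrightarrow> reg s 0 = n \<and> reg s 1 = 1"
    and indep: "\<And>i s S v. I i s S \<Longrightarrow> I i (set_reg x v s) S \<and> I i (set_reg y v s) S"
    and xy: "x < 12" "y < 12" "x \<noteq> y" "1 < x" "1 < y"
    and init: "I 0 s S" and u': "n * (u + 3) + 3 \<le> u'"
  shows "run (for_loop x y c) s S u' (I n)"
proof -
  let ?c = "Seq c (foldr Seq [Calc Add x x 1] (Calc Less y x 0))"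
  let ?J = "\<lambda>i s S. I i s S \<and> reg s x = i \<and> reg s y = of_bool (i < n)"
  have body': "run ?c s S (u + 2) (?J (Suc i))" if "?J i s S" "i < n" for i s S
  proof (rule run_Seq[OF run_mono[OF body[of i s S]]])
    show "i < n" "I i s S" "reg s x = i" "u \<le> u" using that by auto
    fix s' S'
    assume *: "I (Suc i) s' S' \<and> reg s' x = i"
    have "Suc i < 2 ^ w" using that(2) by (intro small_word) simp
    then have e: "effect w (Calc Less y x 0) (effect w (Calc Add x x 1) s') =
      set_reg y (of_bool (Suc i < n)) (set_reg x (Suc i) s')"
      using regs[of "Suc i" s' S'] * xy by simp
    show "run (foldr Seq [Calc Add x x 1] (Calc Less y x 0)) s' S' 2 (?J (Suc i))"
      using xy indep * e
      by (intro run_straight[where u = 1] run_own) auto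
  qed
  have loop: "run (While_nonzero y ?c) s S ((n - i) * (u + 3) + 1) (I n)"
    if "?J i s S" "i \<le> n" for i s S
    using that(2,1)
  proof (induction i arbitrary: s S rule: inc_induct)
    case base
    then show ?case using xy run_while_done[of "I n" s S y] by simp
  next
    case (step i)
    have "run ?c s S (u + 2) (\<lambda>s' S'. run (While_nonzero y ?c) s' S' ((n - Suc i) * (u + 3) + 1) (I n))"
      using step by (intro run_mono[OF body'[of i s S]] step.IH) auto
    then have "run (While_nonzero y ?c) s S ((u + 2) + ((n - Suc i) * (u + 3) + 1) + 1) (I n)"
      by (rule run_while) (use step xy in simp_all)
    moreover have "(u + 2) + ((n - Suc i) * (u + 3) + 1) + 1 = (n - i) * (u + 3) + 1"
      using step.hyps by (simp add: Suc_diff_Suc[symmetric])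
    ultimately show ?case by (simp only:)
  qed
  show ?thesis
    unfolding for_loop_def
  proof (rule run_straight)
    show "list_all own [Const x 0, Calc Less y x 0]" using xy by simp
    have "?J 0 (fold (effect w) [Const x 0, Calc Less y x 0] s) S"
      using indep init regs[OF init] xy n_pos by simp
    from loop[OF this]
    show "run (While_nonzero y ?c) (fold (effect w) [Const x 0, Calc Less y x 0] s) S
      (n * (u + 3) + 1) (I n)" by simp
  qed (use u' in simp)
qed

lemma exec_copy:
  assumes "y < 12" "reg s y < 2 ^ w" "x' = x + 12"
  shows "exec w (Calc Bit_or x' y y) (join s m) 1 (join s (set_reg x (reg s y) m))"
  using exec_Calc[of w Bit_or "x + 12" y y "join s m"] assms by simp

text \<open>The cost 4 stands for one queue operation of at most \<open>b\<close> steps and three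
  copies of arguments, each bounded by \<open>b + 1\<close> steps. The same 4 serves cancellation
  and query, which also need at most three copies.\<close>

lemma run_create:
  assumes x: "x < 12" "reg s x = t" "t < 2 ^ w" "y < 12" "reg s y = key_of v" "key_of v < 2 ^ w"
    and n: "reg s 0 = n"
    and legal: "real t \<notin> dom S" "consistent iv (S(real t \<mapsto> v))" "num_keys iv (S(real t \<mapsto> v)) \<le> n"
      "t < B" "key_of v < B"
    and Q: "Q s (S(real t \<mapsto> v))"
  shows "run (create (program D (Create (real t) v)) x y) s S 4 Q"
  unfolding run_def
proof (intro allI impI)
  fix m l
  assume "ready S m (l + 4)"
  then have r: "ready S m (Suc l)" by (rule ready_mono) simp
  let ?x = "Create (real t) v"
  have "legal_operation iv S ?x" "num_keys iv (apply_operation ?x S) \<le> n" "operation_below B ?x"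
    using legal by auto
  from ready_operation[OF r this] obtain k m' where *:
    "exec w (program D ?x) (pass_arguments n ?x m) k m'" "k \<le> b"
    "ready (S(real t \<mapsto> v)) m' l" by auto
  have nw: "n < 2 ^ w" by (rule small_word) simp
  have "exec w (create (program D ?x) x y) (join s m) (1 + (1 + (1 + k))) (join s m')"
    unfolding create_def
    apply (rule exec_Seq, rule exec_copy[where x = 0], use n nw in simp, use n nw in simp, simp)
    apply (rule exec_Seq, rule exec_copy[where x = 1], use x in simp, use x in simp, simp)
    apply (rule exec_Seq, rule exec_copy[where x = 2], use x in simp, use x in simp, simp)
    apply (rule exec_relocate)
    using *(1) x n by simp
  moreover have "1 + (1 + (1 + k)) \<le> 4 * (b + 1)" using *(2) by simp
  ultimately show "\<exists>k s' m' S'. exec w (create (program D ?x) x y) (join s m) k (join s' m')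
    \<and> k \<le> 4 * (b + 1) \<and> Q s' S' \<and> ready S' m' l" using *(3) Q by blast
qed

lemma exec_call:
  assumes x: "x < 12" "reg s x = t" "t < 2 ^ w" "reg s 0 = n"
    and "exec w p (set_reg 1 t (set_reg 0 n m)) k m'"
  shows "exec w (call p x) (join s m) (1 + (1 + k)) (join s m')"
proof -
  have nw: "n < 2 ^ w" by (rule small_word) simp
  show ?thesis
    unfolding call_def
    apply (rule exec_Seq, rule exec_copy[where x = 0], use x nw in simp, use x nw in simp, simp)
    apply (rule exec_Seq, rule exec_copy[where x = 1], use x in simp, use x in simp, simp)
    apply (rule exec_relocate)
    using assms by simp
qed

lemma run_cancel:
  assumes x: "x < 12" "reg s x = t" "t < 2 ^ w" "reg s 0 = n"
    and legal: "real t \<in> dom S" "consistent iv (S(real t := None))"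
      "num_keys iv (S(real t := None)) \<le> n" "t < B"
    and Q: "Q s (S(real t := None))"
  shows "run (call (cancel D) x) s S 4 Q"
  unfolding run_def
proof (intro allI impI)
  fix m l
  assume "ready S m (l + 4)"
  then have r: "ready S m (Suc l)" by (rule ready_mono) simp
  let ?x = "Cancel (real t)"
  have "legal_operation iv S ?x" "num_keys iv (apply_operation ?x S) \<le> n" "operation_below B ?x"
    using legal by auto
  from ready_operation[OF r this] obtain k m' where *:
    "exec w (program D ?x) (pass_arguments n ?x m) k m'" "k \<le> b"
    "ready (S(real t := None)) m' l" by auto
  have "exec w (call (cancel D) x) (join s m) (1 + (1 + k)) (join s m')"
    using *(1) by (intro exec_call[OF x]) simp
  moreover have "1 + (1 + k) \<le> 4 * (b + 1)" using *(2) by simp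
  ultimately show "\<exists>k s' m' S'. exec w (call (cancel D) x) (join s m) k (join s' m')
    \<and> k \<le> 4 * (b + 1) \<and> Q s' S' \<and> ready S' m' l" using *(3) Q by blast
qed

lemma run_ask:
  assumes x: "x < 12" "reg s x = t" "t < 2 ^ w" "reg s 0 = n" and y: "y < 12"
    and legal: "queue_at iv S (real t) \<noteq> Map.empty" "num_keys iv S \<le> n" "t < B"
    and fm: "find_max iv S (real t) = v" "v < 2 ^ w"
    and Q: "Q (set_reg y v s) S"
  shows "run (ask (query D) x y) s S 4 Q"
  unfolding run_def
proof (intro allI impI)
  fix m l
  assume "ready S m (l + 4)"
  then have r: "ready S m (Suc l)" by (rule ready_mono) simp
  let ?x = "Find_max (real t)"
  have "legal_operation iv S ?x" "num_keys iv (apply_operation ?x S) \<le> n" "operation_below B ?x"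
    using legal by auto
  from ready_operation[OF r this] obtain k m' where *:
    "exec w (program D ?x) (pass_arguments n ?x m) k m'" "k \<le> b" "reg m' 0 = v"
    "ready S m' l" unfolding apply_operation.simps fm(1)[symmetric] by blast
  have "exec w (call (query D) x) (join s m) (1 + (1 + k)) (join s m')"
    using *(1) by (intro exec_call[OF x]) simp
  moreover have "exec w (Calc Bit_or y 12 12) (join s m') 1 (join (set_reg y v s) m')"
    using exec_Calc[of w Bit_or y 12 12 "join s m'"] y fm(2) *(3) reg_join(2)[of s m' 0] by simp
  ultimately have "exec w (ask (query D) x y) (join s m) (1 + (1 + k) + 1) (join (set_reg y v s) m')"
    unfolding ask_def by (rule exec_Seq)
  moreover have "1 + (1 + k) + 1 \<le> 4 * (b + 1)" using *(2) by simp
  ultimately show "\<exists>k s' m' S'. exec w (ask (query D) x y) (join s m) k (join s' m')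
    \<and> k \<le> 4 * (b + 1) \<and> Q s' S' \<and> ready S' m' l" using *(4) Q by blast
qed


section \<open>Histories on a grid of time slots\<close>

text \<open>
  The slot \<open>(r, j)\<close> with \<open>j < n\<close> is reserved for key \<open>j\<close>, and \<open>(r, n)\<close> for a query that sees exactly
  the rows up to \<open>r\<close>.  Row 0 holds the insertions, all other rows hold increments.
\<close>

definition time :: "nat \<times> nat \<Rightarrow> nat" where
  "time p = fst p * (n + 1) + snd p"

definition cell :: "nat \<times> nat \<Rightarrow> update" where
  "cell p = (if fst p = 0 then Insert_key (snd p) else Increase_key (snd p))"

text \<open>The update at a slot is determined by the slot, so a history is encoded by its set
  \<open>Y\<close> of occupied slots. The inverse of \<open>time\<close> is taken on all of
  \<open>UNIV \<times> {..<n}\<close> and hence does not depend on \<open>Y\<close>; this turns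
  insertion into and removal from \<open>Y\<close> into pointwise changes of the history.\<close>

definition hist :: "(nat \<times> nat) set \<Rightarrow> history" where
  "hist Y t = (if t \<in> (\<lambda>p. real (time p)) ` Y
     then Some (cell (inv_into (UNIV \<times> {..<n}) (\<lambda>p. real (time p)) t)) else None)"

definition slots :: "(nat \<times> nat) set \<Rightarrow> bool" where
  "slots Y \<longleftrightarrow> finite Y \<and> (\<forall>(r, j)\<in>Y. j < n \<and> (0, j) \<in> Y)"

lemma time_less:
  assumes "r < q" "j \<le> n"
  shows "time (r, j) < time (q, k)"
proof -
  have "Suc r * (n + 1) \<le> q * (n + 1)" using assms(1) by (intro mult_le_mono1) simp
  with assms show ?thesis by (simp add: time_def)
qed

lemma time_eq:
  assumes "j \<le> n" "j' \<le> n"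
  shows "time (r, j) = time (r', j') \<longleftrightarrow> r = r' \<and> j = j'"
proof (cases r r' rule: linorder_cases)
  case less
  with time_less[OF less assms(1), of j'] show ?thesis by simp
next
  case greater
  with time_less[OF greater assms(2), of j] show ?thesis by simp
qed (simp add: time_def)

lemma time_le:
  assumes "j \<le> n"
  shows "time (r, j) \<le> time (q, n) \<longleftrightarrow> r \<le> q"
proof
  assume "r \<le> q"
  then have "r * (n + 1) \<le> q * (n + 1)" by (rule mult_le_mono1)
  with assms show "time (r, j) \<le> time (q, n)" by (simp add: time_def)
next
  assume "time (r, j) \<le> time (q, n)"
  then have "r * (n + 1) < (q + 1) * (n + 1)" by (simp add: time_def)
  then show "r \<le> q" by (metis Suc_eq_plus1 less_Suc_eq_le mult_less_cancel2)
qed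

text \<open>The rows in use are 0 for insertions, 1 for the vector, 2 to n + 1 for lifting the keys,
  and two rows for each matrix row, so they end at 3 * n + 1.\<close>

lemma time_bound:
  assumes "r \<le> 3 * n + 2" "j \<le> n"
  shows "time (r, j) < 4 * (n + 1)\<^sup>2"
proof -
  have "r * (n + 1) \<le> (3 * n + 2) * (n + 1)" using assms(1) by (rule mult_le_mono1)
  with assms(2) show ?thesis by (simp add: time_def power2_eq_square algebra_simps)
qed

lemma time_inj: "inj_on (\<lambda>p. real (time p)) (UNIV \<times> {..<n})"
  by (rule inj_onI) (auto simp: time_eq)

lemma hist_Some:
  assumes "Y \<subseteq> UNIV \<times> {..<n}"
  shows "hist Y t = Some u \<longleftrightarrow> (\<exists>p\<in>Y. t = real (time p) \<and> u = cell p)"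
proof (cases "t \<in> (\<lambda>p. real (time p)) ` Y")
  case True
  then obtain p where p: "p \<in> Y" "t = real (time p)" by blast
  have p': "p \<in> UNIV \<times> {..<n}" using p(1) assms by (rule rev_subsetD)
  have "hist Y t = Some (cell p)"
    using True inv_into_f_f[OF time_inj p'] by (simp add: hist_def p(2))
  moreover have "p' = p" if "p' \<in> Y" "t = real (time p')" for p'
  proof (rule inj_onD[OF time_inj _ _ p'])
    show "p' \<in> UNIV \<times> {..<n}" using that(1) assms by (rule rev_subsetD)
    show "real (time p') = real (time p)" using that(2) p(2) by simp
  qed
  ultimately show ?thesis using p by (metis option.inject)
next
  case False
  then have "hist Y t = None" by (simp add: hist_def)
  with False show ?thesis by auto
qed

lemma hist_in:
  assumes "Y \<subseteq> UNIV \<times> {..<n}" "p \<in> UNIV \<times> {..<n}"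
  shows "real (time p) \<in> dom (hist Y) \<longleftrightarrow> p \<in> Y"
proof -
  have "real (time p) \<in> dom (hist Y) \<longleftrightarrow> real (time p) \<in> (\<lambda>p. real (time p)) ` Y"
    by (auto simp: hist_def split: if_splits)
  then show ?thesis using inj_on_image_mem_iff[OF time_inj assms(2,1)] by simp
qed

lemma hist_insert:
  assumes "insert p Y \<subseteq> UNIV \<times> {..<n}"
  shows "hist (insert p Y) = (hist Y)(real (time p) \<mapsto> cell p)"
proof
  fix t
  have "inv_into (UNIV \<times> {..<n}) (\<lambda>p. real (time p)) (real (time p)) = p"
    using inv_into_f_f[OF time_inj, of p] assms by blast
  then show "hist (insert p Y) t = ((hist Y)(real (time p) \<mapsto> cell p)) t"
    by (simp add: hist_def)
qed

lemma hist_remove: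
  assumes "insert p Y \<subseteq> UNIV \<times> {..<n}"
  shows "hist (Y - {p}) = (hist Y)(real (time p) := None)"
proof
  fix t
  have "(\<lambda>p. real (time p)) ` (Y - {p}) = (\<lambda>p. real (time p)) ` Y - (\<lambda>p. real (time p)) ` {p}"
    using assms by (intro inj_on_image_set_diff[OF time_inj]) auto
  then show "hist (Y - {p}) t = ((hist Y)(real (time p) := None)) t"
    by (auto simp: hist_def)
qed

lemma hist_empty [simp]: "hist {} = Map.empty"
  by (simp add: hist_def fun_eq_iff)

lemma slots_subset: "slots Y \<Longrightarrow> Y \<subseteq> UNIV \<times> {..<n}"
  by (auto simp: slots_def)

lemma hist_Insert:
  assumes "slots Y"
  shows "hist Y t = Some (Insert_key k) \<longleftrightarrow> (0, k) \<in> Y \<and> t = real (time (0, k))"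
  unfolding hist_Some[OF slots_subset[OF assms]] by (auto simp: cell_def split: if_splits)

lemma hist_Increase:
  assumes "slots Y"
  shows "hist Y t = Some (Increase_key k) \<longleftrightarrow> (\<exists>r>0. (r, k) \<in> Y \<and> t = real (time (r, k)))"
  unfolding hist_Some[OF slots_subset[OF assms]]
proof
  assume "\<exists>p\<in>Y. t = real (time p) \<and> Increase_key k = cell p"
  then obtain r j where "(r, j) \<in> Y" "t = real (time (r, j))" "Increase_key k = cell (r, j)" by auto
  then show "\<exists>r>0. (r, k) \<in> Y \<and> t = real (time (r, k))"
    by (auto simp: cell_def split: if_splits)
next
  assume "\<exists>r>0. (r, k) \<in> Y \<and> t = real (time (r, k))"
  then show "\<exists>p\<in>Y. t = real (time p) \<and> Increase_key k = cell p"
    by (auto simp: cell_def intro!: bexI)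
qed

lemma well_formed_hist:
  assumes Y: "slots Y"
  shows "well_formed (hist Y)"
  unfolding well_formed_def
proof (intro conjI allI impI)
  have "dom (hist Y) \<subseteq> (\<lambda>p. real (time p)) ` Y"
    by (auto simp: hist_def split: if_splits)
  then show "finite (dom (hist Y))"
    by (rule finite_subset) (use Y in \<open>simp add: slots_def\<close>)
next
  fix t t' k
  assume "hist Y t = Some (Insert_key k)" "hist Y t' = Some (Insert_key k)"
  then show "t = t'" using Y by (simp add: hist_Insert)
next
  fix t k
  assume "hist Y t = Some (Increase_key k)"
  then obtain r where r: "0 < r" "(r, k) \<in> Y" "t = real (time (r, k))"
    using Y by (auto simp: hist_Increase)
  then have "(0, k) \<in> Y" "k < n" using Y by (auto simp: slots_def)
  moreover have "time (0, k) < time (r, k)"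
    using r \<open>k < n\<close> by (intro time_less) auto
  ultimately show "\<exists>t'<t. hist Y t' = Some (Insert_key k)"
    using r Y by (intro exI[of _ "real (time (0, k))"]) (simp add: hist_Insert)
qed

lemma num_keys_hist:
  assumes Y: "slots Y"
  shows "num_keys iv (hist Y) \<le> n"
proof -
  have "k \<in> dom (replay iv (hist Y) UNIV) \<longleftrightarrow> (\<exists>t\<in>UNIV. hist Y t = Some (Insert_key k))" for k
    by (rule dom_replay_well_formed[OF well_formed_hist[OF Y]]) simp
  then have "dom (replay iv (hist Y) UNIV) \<subseteq> {k. (0, k) \<in> Y}"
    by (auto simp: hist_Insert[OF Y])
  also have "\<dots> \<subseteq> {..<n}" using Y by (auto simp: slots_def)
  finally have "dom (replay iv (hist Y) UNIV) \<subseteq> {..<n}" .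
  from card_mono[OF _ this] show ?thesis by (simp add: num_keys_def)
qed

definition value_at :: "(nat \<times> nat) set \<Rightarrow> nat \<Rightarrow> nat \<Rightarrow> nat" where
  "value_at Y q k = iv k + card {r. (r, k) \<in> Y \<and> 0 < r \<and> r \<le> q}"

text \<open>Column \<open>n\<close> comes after the columns of all keys, so the query time
  \<open>(q, n)\<close> separates the rows up to \<open>q\<close> from the later ones. As
  \<open>time\<close> is injective, counting increments amounts to counting rows.\<close>

lemma queue_at_hist:
  assumes Y: "slots Y" and ins: "\<forall>j<n. (0, j) \<in> Y"
  shows "queue_at iv (hist Y) (real (time (q, n))) =
    (\<lambda>k. if k < n then Some (value_at Y q k) else None)"
proof
  fix k
  let ?A = "{..real (time (q, n))}"
  have k: "(r, k) \<in> Y \<Longrightarrow> k < n" for r using Y by (auto simp: slots_def)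
  have le: "(r, k) \<in> Y \<Longrightarrow> time (r, k) \<le> time (q, n) \<longleftrightarrow> r \<le> q" for r
    using k[of r] by (intro time_le) simp
  have eq: "{t \<in> ?A. hist Y t = Some (Increase_key k)} =
    (\<lambda>r. real (time (r, k))) ` {r. (r, k) \<in> Y \<and> 0 < r \<and> r \<le> q}"
    using le by (auto simp: hist_Increase[OF Y])
  have "inj_on (\<lambda>r. real (time (r, k))) {r. (r, k) \<in> Y \<and> 0 < r \<and> r \<le> q}"
  proof (rule inj_onI)
    fix r r'
    assume "r \<in> {r. (r, k) \<in> Y \<and> 0 < r \<and> r \<le> q}" "real (time (r, k)) = real (time (r', k))"
    then show "r = r'" using k[of r] time_eq[of k k r r'] by simp
  qed
  then have card: "card {t \<in> ?A. hist Y t = Some (Increase_key k)} =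
    card {r. (r, k) \<in> Y \<and> 0 < r \<and> r \<le> q}"
    unfolding eq by (rule card_image)
  have ex: "(\<exists>t\<in>?A. hist Y t = Some (Insert_key k)) \<longleftrightarrow> k < n"
    using ins k[of 0] le[of 0] by (auto simp: hist_Insert[OF Y])
  have down: "\<forall>t\<in>?A. \<forall>t'<t. t' \<in> ?A" by simp
  show "queue_at iv (hist Y) (real (time (q, n))) k =
    (if k < n then Some (value_at Y q k) else None)"
    unfolding queue_at_def replay_well_formed[OF well_formed_hist[OF Y] down] ex card value_at_def ..
qed

lemma find_max_hist:
  assumes "slots Y" "\<forall>j<n. (0, j) \<in> Y"
  shows "find_max iv (hist Y) (real (time (q, n))) = Max (value_at Y q ` {..<n})"
proof -
  have "ran (\<lambda>k. if k < n then Some (value_at Y q k) else None) = value_at Y q ` {..<n}"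
    by (auto simp: ran_def)
  then show ?thesis unfolding find_max_def queue_at_hist[OF assms] by simp
qed

lemma key_of_cell [simp]: "key_of (cell p) = snd p"
  by (simp add: cell_def)

lemma slot_bounds:
  assumes "r \<le> 3 * n + 2" "j \<le> n"
  shows "time (r, j) < 2 ^ w" "time (r, j) < B" "j < 2 ^ w" "j < B"
proof -
  show "time (r, j) < 2 ^ w" using time_bound[OF assms] by (intro less_word) simp
  show "time (r, j) < B" using time_bound[OF assms] times_below by linarith
  have "j < 4 * (n + 1)\<^sup>2" using time_bound[of 0 j] assms by (simp add: time_def)
  then show "j < B" "j < 2 ^ w" using times_below less_word[of j] by linarith+
qed

text \<open>Legality is now a matter of sets: \<open>slots\<close> before and after the change gives
  consistency and the bound on the number of keys.\<close>

lemma run_create_slot: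
  assumes p: "slots (insert (r, j) Y)" "(r, j) \<notin> Y" "slots Y" "r \<le> 3 * n + 2"
    and s: "x < 12" "y < 12" "reg s x = time (r, j)" "reg s y = j" "reg s 0 = n"
    and Q: "Q s (hist (insert (r, j) Y))"
    and c: "c = (if r = 0 then create_insert D else create_increase D)"
  shows "run (create c x y) s (hist Y) 4 Q"
proof -
  have j: "j \<le> n" using p(1) by (auto simp: slots_def)
  have c': "c = program D (Create (real (time (r, j))) (cell (r, j)))"
    by (simp add: c cell_def)
  have sub: "insert (r, j) Y \<subseteq> UNIV \<times> {..<n}" by (rule slots_subset) fact
  note upd = hist_insert[OF sub]
  show ?thesis
    unfolding c'
  proof (rule run_create)
    show "real (time (r, j)) \<notin> dom (hist Y)"
      using hist_in[of Y "(r, j)"] sub p(2) by blast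
    show "consistent iv ((hist Y)(real (time (r, j)) \<mapsto> cell (r, j)))"
      unfolding upd[symmetric] by (intro consistent_well_formed well_formed_hist p)
    show "num_keys iv ((hist Y)(real (time (r, j)) \<mapsto> cell (r, j))) \<le> n"
      unfolding upd[symmetric] by (intro num_keys_hist p)
    show "Q s ((hist Y)(real (time (r, j)) \<mapsto> cell (r, j)))"
      unfolding upd[symmetric] by (rule Q)
  qed (use s slot_bounds[OF p(4) j] in simp_all)
qed

lemma run_cancel_slot:
  assumes p: "slots (Y - {(r, j)})" "(r, j) \<in> Y" "slots Y" "r \<le> 3 * n + 2"
    and s: "x < 12" "reg s x = time (r, j)" "reg s 0 = n"
    and Q: "Q s (hist (Y - {(r, j)}))"
  shows "run (call (cancel D) x) s (hist Y) 4 Q"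
proof -
  have j: "j \<le> n" using p(2,3) by (auto simp: slots_def)
  have sub: "insert (r, j) Y \<subseteq> UNIV \<times> {..<n}" using slots_subset[OF p(3)] p(2) by blast
  note upd = hist_remove[OF sub]
  show ?thesis
  proof (rule run_cancel)
    show "real (time (r, j)) \<in> dom (hist Y)"
      using hist_in[of Y "(r, j)"] sub p(2) by blast
    show "consistent iv ((hist Y)(real (time (r, j)) := None))"
      unfolding upd[symmetric] by (intro consistent_well_formed well_formed_hist p)
    show "num_keys iv ((hist Y)(real (time (r, j)) := None)) \<le> n"
      unfolding upd[symmetric] by (intro num_keys_hist p)
    show "Q s ((hist Y)(real (time (r, j)) := None))"
      unfolding upd[symmetric] by (rule Q)
  qed (use s slot_bounds[OF p(4) j] in simp_all)
qed

lemma run_ask_slot: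
  assumes Y: "slots Y" "\<forall>j<n. (0, j) \<in> Y" and q: "q \<le> 3 * n + 2"
    and s: "x < 12" "y < 12" "reg s x = time (q, n)" "reg s 0 = n"
    and v: "Max (value_at Y q ` {..<n}) = v" "v < 2 ^ w"
    and Q: "Q (set_reg y v s) (hist Y)"
  shows "run (ask (query D) x y) s (hist Y) 4 Q"
proof (rule run_ask)
  have "queue_at iv (hist Y) (real (time (q, n))) 0 \<noteq> None"
    unfolding queue_at_hist[OF Y] using n_pos by simp
  then show "queue_at iv (hist Y) (real (time (q, n))) \<noteq> Map.empty" by auto
  show "num_keys iv (hist Y) \<le> n" by (rule num_keys_hist[OF Y(1)])
  show "find_max iv (hist Y) (real (time (q, n))) = v" by (simp add: find_max_hist[OF Y] v)
  show "Q (set_reg y v s) (hist Y)" by (rule Q)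
qed (use s v slot_bounds[OF q] in simp_all)

end


section \<open>The reduction\<close>

text \<open>Slot \<open>(0, j)\<close> has time \<open>j\<close>, so register 2 serves both as the
  time and as the key.\<close>

definition insert_loop :: "retroactive_queue \<Rightarrow> com" where
  "insert_loop D = for_loop 2 3 (create (create_insert D) 2 2)"

text \<open>
  Register 0 holds \<open>n\<close>, 1 the constant 1, 9 and 10 the numbers \<open>n + 1\<close> and \<open>n + 2\<close>; loops count in 2
  and 4.  From a row in register 7, \<open>place\<close> computes the time of a slot in register 6.
\<close>

definition place :: "nat \<Rightarrow> com list" where
  "place x = [Calc Mul 6 7 9, Calc Add 6 6 x]"

text \<open>With \<open>\<beta>\<close> in register 11, the initial value of key \<open>j\<close> is \<open>\<beta> * j\<close>, and \<open>n - \<beta> * j\<close> increments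
  lift it to \<open>n\<close>.\<close>

definition pad_step :: "retroactive_queue \<Rightarrow> com" where
  "pad_step D = foldr Seq [Calc Mul 7 11 4, Calc Less 7 2 7]
       (If_nonzero 7 Skip
         (foldr Seq ([Calc Add 7 2 1, Calc Add 7 7 1] @ place 4)
           (create (create_increase D) 6 4)))"

definition pad_loop :: "retroactive_queue \<Rightarrow> com" where
  "pad_loop D = for_loop 2 3 (for_loop 4 5 (pad_step D))"

text \<open>The comparison with 1 negates the matrix bit. Adding the counter twice and then
  \<open>n + 2\<close> yields the row \<open>n + 2 + 2 * i\<close> for an entry 1 and the next row
  for an entry 0.\<close>

definition entry_step :: "retroactive_queue \<Rightarrow> com" where
  "entry_step D = foldr Seq ([Calc Mul 8 2 0, Calc Add 8 8 4, Load 7 0 8, Calc Less 7 7 1,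
          Calc Add 7 7 2, Calc Add 7 7 2, Calc Add 7 7 10] @ place 4)
        (create (create_increase D) 6 4)"

definition entry_loop :: "retroactive_queue \<Rightarrow> com" where
  "entry_loop D = for_loop 2 3 (for_loop 4 5 (entry_step D))"

definition prepare :: "retroactive_queue \<Rightarrow> nat \<Rightarrow> com" where
  "prepare D \<beta> = foldr Seq [Const 1 1, Const 11 \<beta>, Calc Add 9 0 1, Calc Add 10 9 1]
     (Seq (insert_loop D) (Seq (pad_loop D) (entry_loop D)))"

text \<open>The sum of \<open>n + 1\<close> and \<open>j\<close> is the time of slot
  \<open>(1, j)\<close>. The program \<open>c\<close> is left open because the same loop creates the
  increments of a vector and later cancels them.\<close>

definition vector_loop :: "com \<Rightarrow> com" where
  "vector_loop c = for_loop 2 3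
     (foldr Seq [Load 7 1 2, Calc Add 6 9 2] (If_nonzero 7 c Skip))"

text \<open>Register 0 contains \<open>n\<close>, which is also the column of queries; hence
  \<open>place 0\<close>. The answer is compared with \<open>n + 2 + i\<close>, the value of a key
  with both bits set.\<close>

definition query_loop :: "retroactive_queue \<Rightarrow> com" where
  "query_loop D = for_loop 2 3
     (foldr Seq ([Calc Add 7 2 2, Calc Add 7 7 10] @ place 0)
       (Seq (ask (query D) 6 7) (foldr Seq [Calc Add 8 2 10, Calc Equal 7 7 8] (Store 2 2 7))))"

definition answer :: "retroactive_queue \<Rightarrow> com" where
  "answer D = Seq (vector_loop (create (create_increase D) 6 2))
     (Seq (query_loop D) (vector_loop (call (cancel D) 6)))"

text \<open>The values 0 and 1 of \<beta> treat \<open>iv k = 0\<close> and \<open>iv k = k\<close>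
  uniformly.\<close>

locale omv_reduction = queue_machine +
  fixes \<beta> :: nat and M :: "nat \<Rightarrow> nat \<Rightarrow> bool"
  assumes iv_eq: "iv = (\<lambda>k. \<beta> * k)" and \<beta>: "\<beta> \<le> 1"
begin

section \<open>The slots of the reduction and the values they produce\<close>

definition inserts :: "nat \<Rightarrow> (nat \<times> nat) set" where
  "inserts j = {(0, k) |k. k < j}"

text \<open>Key \<open>k\<close> needs \<open>n - iv k\<close> increments to reach \<open>n\<close>.
  Putting them where \<open>iv k \<le> q\<close> lets the program decide each slot by one
  comparison.\<close>

definition pads :: "nat \<Rightarrow> (nat \<times> nat) set" where
  "pads p = {(2 + q, k) |q k. q < p \<and> k < n \<and> iv k \<le> q}"

text \<open>Every key is increased once for every matrix row \<open>i\<close>: before the query of that row if the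
  entry is 1, and after it otherwise.\<close>

definition entry :: "nat \<Rightarrow> nat \<Rightarrow> nat \<times> nat" where
  "entry i k = (n + 2 + 2 * i + of_bool (\<not> M i k), k)"

definition entries :: "nat \<Rightarrow> (nat \<times> nat) set" where
  "entries i = {entry i' k |i' k. i' < i \<and> k < n}"

definition matrix_slots :: "(nat \<times> nat) set" where
  "matrix_slots = inserts n \<union> pads n \<union> entries n"

text \<open>Row 1 lies after the insertions and before all queries. The set \<open>K\<close>
  describes partial progress: an initial segment while increments are created, a final segment while
  they are cancelled.\<close>

definition vector_slots :: "(nat \<Rightarrow> bool) \<Rightarrow> nat set \<Rightarrow> (nat \<times> nat) set" where
  "vector_slots v K = {(1, k) |k. k < n \<and> k \<in> K \<and> v k}"

lemmas slot_defs = inserts_def pads_def entry_def entries_def matrix_slots_def vector_slots_def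

lemma iv_less: "k < n \<Longrightarrow> iv k < n"
proof -
  assume "k < n"
  moreover have "iv k \<le> 1 * k" unfolding iv_eq using \<beta> by (rule mult_le_mono1)
  ultimately show ?thesis by simp
qed

lemma finite_slots [simp]:
  "finite (inserts j)" "finite (pads p)" "finite (entries i)" "finite (vector_slots v K)"
proof -
  have "inserts j = (\<lambda>k. (0, k)) ` {..<j}" by (auto simp: inserts_def)
  then show "finite (inserts j)" by simp
  have "pads p \<subseteq> (\<lambda>(q, k). (2 + q, k)) ` ({..<p} \<times> {..<n})" by (auto simp: pads_def)
  then show "finite (pads p)" by (rule finite_subset) simp
  have "entries i = (\<lambda>(i', k). entry i' k) ` ({..<i} \<times> {..<n})" by (auto simp: entries_def)
  then show "finite (entries i)" by simp
  have "vector_slots v K \<subseteq> (\<lambda>k. (1, k)) ` {..<n}" by (auto simp: vector_slots_def)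
  then show "finite (vector_slots v K)" by (rule finite_subset) simp
qed

lemma slots_inserts: "j \<le> n \<Longrightarrow> slots (inserts j)"
  by (auto simp: slots_def inserts_def)

lemma pads_subset: "pads p \<subseteq> UNIV \<times> {..<n}"
  and entries_subset: "entries i \<subseteq> UNIV \<times> {..<n}"
  by (auto simp: pads_def entries_def entry_def)

lemma slotsI:
  assumes "finite Y" "Y \<subseteq> UNIV \<times> {..<n}"
  shows "slots (inserts n \<union> Y)"
proof -
  have "(0, k) \<in> inserts n" if "k < n" for k using that by (simp add: inserts_def)
  moreover have "inserts n \<subseteq> UNIV \<times> {..<n}" by (auto simp: inserts_def)
  ultimately show ?thesis using assms by (auto simp: slots_def)
qed

lemma slots_matrix: "slots (matrix_slots \<union> vector_slots v K)"
proof -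
  have "pads n \<union> (entries n \<union> vector_slots v K) \<subseteq> UNIV \<times> {..<n}" by (auto simp: slot_defs)
  then show ?thesis unfolding matrix_slots_def Un_assoc by (intro slotsI) auto
qed

text \<open>The visible rows contain all \<open>n - iv k\<close> pads, one entry of each earlier
  matrix row, since even the late position for \<open>i' < i\<close> is at most
  \<open>n + 1 + 2 * i\<close>, and the entry of row \<open>i\<close> only in its early position,
  that is, if \<open>M i k\<close>.\<close>

lemma value_at_query:
  assumes i: "i < n" and k: "k < n"
  shows "value_at (matrix_slots \<union> vector_slots v UNIV) (n + 2 + 2 * i) k =
    n + i + of_bool (M i k) + of_bool (v k)"
proof -
  let ?f = "\<lambda>i'. n + 2 + 2 * i' + of_bool (\<not> M i' k)"
  let ?A = "(+) 2 ` {iv k..<n}"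
  let ?B = "?f ` ({..<i} \<union> (if M i k then {i} else {}))"
  let ?C = "if v k then {1 :: nat} else {}"
  have eq: "{r. (r, k) \<in> matrix_slots \<union> vector_slots v UNIV \<and> 0 < r \<and> r \<le> n + 2 + 2 * i} =
    ?A \<union> (?B \<union> ?C)"
  proof (intro set_eqI iffI)
    fix r
    assume "r \<in> {r. (r, k) \<in> matrix_slots \<union> vector_slots v UNIV \<and> 0 < r \<and> r \<le> n + 2 + 2 * i}"
    then have r: "0 < r" "r \<le> n + 2 + 2 * i"
      and "(r, k) \<in> inserts n \<or> (r, k) \<in> pads n \<or> (r, k) \<in> entries n \<or> (r, k) \<in> vector_slots v UNIV"
      by (simp_all add: matrix_slots_def)
    then consider "(r, k) \<in> pads n" | "(r, k) \<in> entries n" | "(r, k) \<in> vector_slots v UNIV"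
      by (auto simp: inserts_def)
    then show "r \<in> ?A \<union> (?B \<union> ?C)"
    proof cases
      case 1
      then show ?thesis by (auto simp: pads_def)
    next
      case 2
      then obtain i' where i': "r = ?f i'" by (auto simp: entries_def entry_def)
      with r(2) have "i' < i \<or> i' = i \<and> M i k" by (cases "M i' k"; cases "i' = i") simp_all
      then have "i' \<in> {..<i} \<union> (if M i k then {i} else {})" by auto
      with i' show ?thesis by blast
    next
      case 3
      then show ?thesis by (simp add: vector_slots_def)
    qed
  next
    fix r
    assume "r \<in> ?A \<union> (?B \<union> ?C)"
    then consider "r \<in> ?A" | "r \<in> ?B" | "r \<in> ?C" by blast
    then show "r \<in> {r. (r, k) \<in> matrix_slots \<union> vector_slots v UNIV \<and> 0 < r \<and> r \<le> n + 2 + 2 * i}"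
    proof cases
      case 1
      then obtain q where q: "r = 2 + q" "iv k \<le> q" "q < n" by auto
      then have "(r, k) \<in> pads n" using k by (simp add: pads_def)
      with q show ?thesis by (simp add: matrix_slots_def)
    next
      case 2
      then obtain i' where r: "r = ?f i'" and i': "i' \<in> {..<i} \<union> (if M i k then {i} else {})"
        by (rule imageE)
      then have i': "i' < i \<or> i' = i \<and> M i k" by (simp split: if_splits)
      have "(r, k) = entry i' k" "i' < n" using r i i' by (auto simp: entry_def)
      with k have "(r, k) \<in> entries n" unfolding entries_def by blast
      moreover have "r \<le> n + 2 + 2 * i" unfolding r using i' by (cases "M i' k") auto
      moreover have "0 < r" unfolding r by simp
      ultimately show ?thesis by (simp add: matrix_slots_def)
    next
      case 3
      then have "(r, k) \<in> vector_slots v UNIV" "r = 1"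
        using k by (auto simp: vector_slots_def split: if_splits)
      then show ?thesis by simp
    qed
  qed
  have "inj_on ?f X" for X
  proof (rule inj_onI)
    fix x y
    assume "?f x = ?f y"
    then show "x = y" by (cases "M x k"; cases "M y k"; simp; presburger)
  qed
  then have B: "card ?B = i + of_bool (M i k)"
    by (subst card_image) (auto simp: card_insert_if)
  have A: "card ?A = n - iv k" by (subst card_image) (simp_all add: inj_on_def)
  have C: "card ?C = of_bool (v k)" by simp
  \<comment> \<open>The three parts occupy different rows: \<open>?C\<close> row 1,
    \<open>?A\<close> rows 2 to n + 1, \<open>?B\<close> rows from n + 2 on.\<close>
  have "card (?A \<union> (?B \<union> ?C)) = card ?A + card (?B \<union> ?C)"
    by (rule card_Un_disjoint) auto
  also have "card (?B \<union> ?C) = card ?B + card ?C"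
    by (rule card_Un_disjoint) auto
  finally show ?thesis
    unfolding value_at_def eq A B C using iv_less[OF k] by simp
qed

text \<open>Both bits together contribute at most 2. The upper bound makes equality a test for a key
  that attains it, and also shows that the answer of the query fits into a word.\<close>

lemma find_max_query:
  assumes "i < n"
  shows "Max (value_at (matrix_slots \<union> vector_slots v UNIV) (n + 2 + 2 * i) ` {..<n}) = n + 2 + i
    \<longleftrightarrow> bool_mult_vec n M v i"
    and "Max (value_at (matrix_slots \<union> vector_slots v UNIV) (n + 2 + 2 * i) ` {..<n}) \<le> n + 2 + i"
proof -
  let ?f = "value_at (matrix_slots \<union> vector_slots v UNIV) (n + 2 + 2 * i)"
  have ne: "?f ` {..<n} \<noteq> {}" using n_pos by auto
  have "?f k \<le> n + 2 + i" if "k < n" for k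
    unfolding value_at_query[OF assms that] by (simp add: of_bool_def)
  then show *: "Max (?f ` {..<n}) \<le> n + 2 + i"
    using ne by (intro Max.boundedI) auto
  show "Max (?f ` {..<n}) = n + 2 + i \<longleftrightarrow> bool_mult_vec n M v i"
  proof
    assume "Max (?f ` {..<n}) = n + 2 + i"
    then have "n + 2 + i \<in> ?f ` {..<n}" using Max_in[of "?f ` {..<n}"] ne by simp
    then obtain k where k: "k < n" "?f k = n + 2 + i" by auto
    then have "M i k \<and> v k" using value_at_query[OF assms k(1), of v]
      by (cases "M i k"; cases "v k") simp_all
    with k(1) show "bool_mult_vec n M v i" unfolding bool_mult_vec_def by blast
  next
    assume "bool_mult_vec n M v i"
    then obtain k where k: "k < n" "M i k" "v k" unfolding bool_mult_vec_def by blast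
    then have "?f k = n + 2 + i" unfolding value_at_query[OF assms k(1)] by simp
    moreover have "?f k \<le> Max (?f ` {..<n})" using k by (intro Max_ge) auto
    ultimately show "Max (?f ` {..<n}) = n + 2 + i" using * by linarith
  qed
qed

section \<open>Correctness of the preparation for a matrix\<close>

definition configured :: "memory \<Rightarrow> bool" where
  "configured s \<longleftrightarrow> reg s 0 = n \<and> reg s 1 = 1 \<and> reg s 9 = n + 1 \<and> reg s 10 = n + 2 \<and> reg s 11 = \<beta>"

definition holds_matrix :: "memory \<Rightarrow> bool" where
  "holds_matrix s \<longleftrightarrow> (\<forall>i<n. \<forall>j<n. arr s 0 (i * n + j) = of_bool (M i j))"

lemma configured_regs: "configured s \<Longrightarrow> reg s 0 = n" "configured s \<Longrightarrow> reg s 1 = 1" "configured s \<Longrightarrow> reg s 9 = n + 1"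
  "configured s \<Longrightarrow> reg s 10 = n + 2" "configured s \<Longrightarrow> reg s 11 = \<beta>"
  "configured s \<Longrightarrow> reg s (Suc 0) = Suc 0"
  by (simp_all add: configured_def)

lemma configured_set_reg [simp]: "1 < x \<Longrightarrow> x < 9 \<Longrightarrow> configured (set_reg x v s) \<longleftrightarrow> configured s"
  and configured_set_arr [simp]: "configured (set_arr a f s) \<longleftrightarrow> configured s"
  and holds_matrix_set_reg [simp]: "holds_matrix (set_reg x v s) \<longleftrightarrow> holds_matrix s"
  by (auto simp: configured_def holds_matrix_def)

lemma set_reg_set_reg [simp]: "set_reg x u (set_reg x v s) = set_reg x u s"
  by (simp add: set_reg_def)

lemma place_simps [simp]: "list_all own (place x) \<longleftrightarrow> x < 12" "length (place x) = 2"
  by (simp_all add: place_def)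

lemma fold_place:
  assumes "configured s" "reg s 7 = r" "x \<noteq> 6" "reg s x = j" "time (r, j) < 2 ^ w"
  shows "fold (effect w) (place x) s = set_reg 6 (time (r, j)) s"
proof -
  \<comment> \<open>Reduction of the product modulo the word size does no harm: only the final time
    has to fit.\<close>
  have "(r * (n + 1) mod 2 ^ w + j) mod 2 ^ w = time (r, j)"
    using assms(5) by (simp only: mod_add_left_eq) (simp add: time_def)
  then show ?thesis using assms(1-4) by (simp add: place_def configured_regs)
qed

lemma run_insert_loop:
  assumes "configured s" "holds_matrix s"
  shows "run (insert_loop D) s Map.empty (7 * n + 3)
    (\<lambda>s' S'. configured s' \<and> holds_matrix s' \<and> S' = hist (inserts n))"
  unfolding insert_loop_def
proof (rule run_for_loop[where I = "\<lambda>j s S. configured s \<and> holds_matrix s \<and> S = hist (inserts j)"])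
  fix j s S
  assume j: "j < n" and I: "configured s \<and> holds_matrix s \<and> S = hist (inserts j)" and r: "reg s 2 = j"
  have eq: "inserts (Suc j) = insert (0, j) (inserts j)"
    by (auto simp: inserts_def less_Suc_eq)
  have "run (create (create_insert D) 2 2) s (hist (inserts j)) 4
    (\<lambda>s' S'. (configured s' \<and> holds_matrix s' \<and> S' = hist (inserts (Suc j))) \<and> reg s' 2 = j)"
  proof (rule run_create_slot[where r = 0 and j = j])
    show "slots (insert (0, j) (inserts j))"
      unfolding eq[symmetric] using j by (intro slots_inserts) simp
    show "slots (inserts j)" using j by (intro slots_inserts) simp
    show "(0, j) \<notin> inserts j" by (simp add: inserts_def)
    show "(configured s \<and> holds_matrix s \<and> hist (insert (0, j) (inserts j)) = hist (inserts (Suc j)))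
      \<and> reg s 2 = j" using I r by (simp add: eq)
  qed (use I r in \<open>simp_all add: time_def configured_regs\<close>)
  then show "run (create (create_insert D) 2 2) s S 4
    (\<lambda>s' S'. (configured s' \<and> holds_matrix s' \<and> S' = hist (inserts (Suc j))) \<and> reg s' 2 = j)"
    using I by simp
next
  show "configured s \<and> holds_matrix s \<and> Map.empty = hist (inserts 0)"
    using assms by (simp add: inserts_def)
qed (auto simp: configured_regs)

lemma run_pad_step:
  assumes I: "configured s" "holds_matrix s" "reg s 2 = p" "reg s 4 = j" and p: "p < n" and j: "j < n"
    and Y: "Y = inserts n \<union> pads p \<union> {(2 + p, k) |k. k < j \<and> iv k \<le> p}"
    and Y': "Y' = inserts n \<union> pads p \<union> {(2 + p, k) |k. k < Suc j \<and> iv k \<le> p}"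
  shows "run (pad_step D) s (hist Y) 11
    (\<lambda>s' S'. configured s' \<and> holds_matrix s' \<and> reg s' 2 = p \<and> reg s' 4 = j \<and> S' = hist Y')"
    (is "run _ _ _ _ ?Q")
  unfolding pad_step_def
proof (rule run_straight)
  let ?s = "set_reg 7 (of_bool (p < iv j)) (set_reg 7 (iv j) s)"
  have "iv j < 2 ^ w" using iv_less[OF j] by (intro small_word) simp
  then have e: "fold (effect w) [Calc Mul 7 11 4, Calc Less 7 2 7] s = ?s"
    using I by (simp add: configured_regs iv_eq)
  have "run (If_nonzero 7 Skip
         (foldr Seq ([Calc Add 7 2 1, Calc Add 7 7 1] @ place 4)
           (create (create_increase D) 6 4))) ?s (hist Y) (8 + 1) ?Q"
  proof (rule run_If)
    assume "reg ?s 7 \<noteq> 0"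
    \<comment> \<open>The register holds the outcome of \<open>p < iv j\<close>; here key
      \<open>j\<close> starts above \<open>p\<close> and gets no increment in this row.\<close>
    then have "Y' = Y" by (auto simp: Y Y' less_Suc_eq)
    then show "run Skip ?s (hist Y) 8 ?Q"
      using I by (intro run_Skip) auto
  next
    assume "reg ?s 7 = 0"
    then have pj: "iv j \<le> p" by simp
    let ?cs = "[Calc Add 7 2 1, Calc Add 7 7 1] @ place 4"
    let ?s' = "set_reg 6 (time (2 + p, j)) (set_reg 7 (2 + p) ?s)"
    have "time (2 + p, j) < 2 ^ w" using p j by (intro slot_bounds) auto
    moreover have "fold (effect w) [Calc Add 7 2 1, Calc Add 7 7 1] ?s = set_reg 7 (2 + p) ?s"
      using I p small_word[of "p + 1"] small_word[of "p + 2"] by (simp add: configured_regs)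
    ultimately have e: "fold (effect w) ?cs ?s = ?s'"
      unfolding fold_append comp_apply using I by (simp only:) (rule fold_place, auto)
    have "run (create (create_increase D) 6 4) ?s' (hist Y) 4 ?Q"
    proof (rule run_create_slot[where r = "2 + p" and j = j])
      have eq: "Y' = insert (2 + p, j) Y" using pj by (auto simp: Y Y' less_Suc_eq)
      show "slots Y" unfolding Y Un_assoc
        by (rule slotsI) (use j pads_subset in auto)
      have "slots Y'" unfolding Y' Un_assoc
        by (rule slotsI) (use j pads_subset in auto)
      then show "slots (insert (2 + p, j) Y)" by (simp only: eq)
      show "(2 + p, j) \<notin> Y" by (auto simp: Y inserts_def pads_def)
      show "?Q ?s' (hist (insert (2 + p, j) Y))"
        using I eq by simp
    qed (use I p in \<open>auto simp: configured_regs\<close>)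
    then show "run (foldr Seq ?cs (create (create_increase D) 6 4)) ?s (hist Y) 8 ?Q"
      unfolding e[symmetric] by (intro run_straight[where u = 4]) auto
  qed simp
  then show "run (If_nonzero 7 Skip
         (foldr Seq ([Calc Add 7 2 1, Calc Add 7 7 1] @ place 4)
           (create (create_increase D) 6 4)))
     (fold (effect w) [Calc Mul 7 11 4, Calc Less 7 2 7] s) (hist Y) 9 ?Q"
    unfolding e by simp
qed auto

lemma run_pad_loop:
  assumes "configured s" "holds_matrix s"
  shows "run (pad_loop D) s (hist (inserts n)) (n * (14 * n + 6) + 3)
    (\<lambda>s' S'. configured s' \<and> holds_matrix s' \<and> S' = hist (inserts n \<union> pads n))"
  unfolding pad_loop_def
proof (rule run_for_loop[where I = "\<lambda>p s S. configured s \<and> holds_matrix s \<and> S = hist (inserts n \<union> pads p)"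
      and u = "14 * n + 3"])
  fix p s S
  assume p: "p < n" and I: "configured s \<and> holds_matrix s \<and> S = hist (inserts n \<union> pads p)"
    and r: "reg s 2 = p"
  let ?Y = "\<lambda>j. inserts n \<union> pads p \<union> {(2 + p, k) |k. k < j \<and> iv k \<le> p}"
  let ?I = "\<lambda>j s S. configured s \<and> holds_matrix s \<and> reg s 2 = p \<and> S = hist (?Y j)"
  have Yn: "?Y n = inserts n \<union> pads (Suc p)" by (auto simp: pads_def less_Suc_eq)
  have Y0: "?Y 0 = inserts n \<union> pads p" by simp
  show "run (for_loop 4 5 (pad_step D)) s S (14 * n + 3)
    (\<lambda>s' S'. (configured s' \<and> holds_matrix s' \<and> S' = hist (inserts n \<union> pads (Suc p))) \<and> reg s' 2 = p)"
  proof (rule run_mono[OF run_for_loop[where I = ?I and u = 11]])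
    fix j s S
    assume j: "j < n" and J: "?I j s S" and r': "reg s 4 = j"
    then have S: "S = hist (?Y j)" by simp
    show "run (pad_step D) s S 11 (\<lambda>s' S'. ?I (Suc j) s' S' \<and> reg s' 4 = j)"
      unfolding S
      by (rule run_mono[OF run_pad_step[OF _ _ _ r' p j refl refl] order_refl]) (use J in auto)
  next
    show "?I 0 s S" unfolding Y0 using I r by simp
  next
    fix s' S'
    assume "?I n s' S'"
    then show "(configured s' \<and> holds_matrix s' \<and> S' = hist (inserts n \<union> pads (Suc p))) \<and> reg s' 2 = p"
      unfolding Yn by simp
  qed (auto simp: configured_regs)
qed (use assms in \<open>auto simp: configured_regs pads_def\<close>)

text \<open>Consecutive matrix rows are two apart and the bit adds at most 1, so \<open>i\<close>
  can be recovered from the row.\<close>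

lemma entry_eq: "entry i k = entry i' k' \<longleftrightarrow> i = i' \<and> k = k'"
proof
  assume eq: "entry i k = entry i' k'"
  then have "k' = k" by (simp add: entry_def)
  with eq have "2 * i + of_bool (\<not> M i k) = 2 * i' + of_bool (\<not> M i' k)"
    by (simp add: entry_def)
  then have "i = i'" by (cases "M i k"; cases "M i' k"; simp; presburger)
  with \<open>k' = k\<close> show "i = i' \<and> k = k'" by simp
qed simp

lemma entry_fresh: "entry i j \<notin> inserts n \<union> pads n \<union> entries i \<union> entry i ` {..<j}"
proof -
  have "entry i j \<notin> inserts n" "entry i j \<notin> pads n"
    by (auto simp: entry_def inserts_def pads_def)
  moreover have "entry i j \<notin> entries i" "entry i j \<notin> entry i ` {..<j}"
    by (auto simp: entries_def entry_eq)
  ultimately show ?thesis by blast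
qed

lemma slots_entries: "j \<le> n \<Longrightarrow> slots (inserts n \<union> pads n \<union> entries i \<union> entry i ` {..<j})"
proof -
  assume "j \<le> n"
  then have "entry i ` {..<j} \<subseteq> UNIV \<times> {..<n}" by (auto simp: entry_def)
  then have "pads n \<union> (entries i \<union> entry i ` {..<j}) \<subseteq> UNIV \<times> {..<n}"
    using pads_subset entries_subset by (intro Un_least)
  then show ?thesis unfolding Un_assoc by (intro slotsI) simp_all
qed

lemma run_entry_step:
  assumes I: "configured s" "holds_matrix s" "reg s 2 = i" "reg s 4 = j" and i: "i < n" and j: "j < n"
    and Y: "Y = inserts n \<union> pads n \<union> entries i \<union> entry i ` {..<j}"
    and Y': "Y' = inserts n \<union> pads n \<union> entries i \<union> entry i ` {..<Suc j}"
  shows "run (entry_step D) s (hist Y) 13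
    (\<lambda>s' S'. configured s' \<and> holds_matrix s' \<and> reg s' 2 = i \<and> reg s' 4 = j \<and> S' = hist Y')"
    (is "run _ _ _ _ ?Q")
  unfolding entry_step_def
proof (rule run_straight)
  let ?cs = "[Calc Mul 8 2 0, Calc Add 8 8 4, Load 7 0 8, Calc Less 7 7 1,
          Calc Add 7 7 2, Calc Add 7 7 2, Calc Add 7 7 10] @ place 4"
  let ?r = "fst (entry i j)"
  let ?s = "set_reg 6 (time (?r, j)) (set_reg 7 ?r (set_reg 8 (i * n + j) s))"
  have r: "?r \<le> 3 * n + 2" using i by (simp add: entry_def)
  have "i * n + j < n * n"
    using mult_le_mono1[of "Suc i" n n] i j by simp
  then have pos: "i * n + j < 2 ^ w" by (intro less_word) (simp add: power2_eq_square)
  have load: "arr s 0 (i * n + j) = of_bool (M i j)"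
    using I(2) i j by (simp add: holds_matrix_def)
  have row: "?r < 2 ^ w" using r by (intro small_word) simp
  let ?cs' = "[Calc Mul 8 2 0, Calc Add 8 8 4, Load 7 0 8, Calc Less 7 7 1,
          Calc Add 7 7 2, Calc Add 7 7 2, Calc Add 7 7 10]"
  \<comment> \<open>With the negated bit as a symbol, the partial sums below need no case
    distinction; all are at most the final row, which fits into a word.\<close>
  define x :: nat where "x = of_bool (\<not> M i j)"
  have x: "?r = x + i + i + (n + 2)" by (simp add: entry_def x_def)
  have load': "of_bool (arr s 0 (i * n + j) < 1) = x" by (simp add: load x_def)
  have "(i * n mod 2 ^ w + j) mod 2 ^ w = i * n + j"
    using pos by (simp only: mod_add_left_eq) simp
  moreover have "(x + i) mod 2 ^ w = x + i" "(x + i + i) mod 2 ^ w = x + i + i"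
    "(x + i + i + (n + 2)) mod 2 ^ w = x + i + i + (n + 2)"
    using row[unfolded x] by (simp_all del: add_2_eq_Suc')
  moreover have "x mod 2 ^ w = x" by (simp add: x_def)
  ultimately have f: "fold (effect w) ?cs' s = set_reg 7 ?r (set_reg 8 (i * n + j) s)"
    unfolding x using I load' by (simp add: configured_regs)
  have "time (?r, j) < 2 ^ w" using r j by (intro slot_bounds) auto
  then have "fold (effect w) (place 4) (set_reg 7 ?r (set_reg 8 (i * n + j) s)) =
    set_reg 6 (time (?r, j)) (set_reg 7 ?r (set_reg 8 (i * n + j) s))"
    by (intro fold_place) (use I in simp_all)
  then have e: "fold (effect w) ?cs s = set_reg 6 (time (?r, j)) (set_reg 7 ?r (set_reg 8 (i * n + j) s))"
    unfolding fold_append comp_apply f .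
  have s: "configured ?s" "holds_matrix ?s" "reg ?s 2 = i" "reg ?s 4 = j"
    using I by simp_all
  have e': "(?r, j) = entry i j" by (simp add: entry_def)
  have eq: "Y' = insert (?r, j) Y" unfolding e' by (auto simp: Y Y' less_Suc_eq)
  show "run (create (create_increase D) 6 4) (fold (effect w) ?cs s) (hist Y) 4 ?Q"
    unfolding e
  proof (rule run_create_slot[where r = ?r and j = j])
    show "slots Y" unfolding Y using j by (intro slots_entries) simp
    have "slots Y'" unfolding Y' using j by (intro slots_entries) simp
    then show "slots (insert (?r, j) Y)" by (simp only: eq)
    show "(?r, j) \<notin> Y" unfolding e' Y by (rule entry_fresh)
    show "?Q ?s (hist (insert (?r, j) Y))" using s eq by simp
    show "reg ?s 6 = time (?r, j)" by simp
    show "create_increase D = (if ?r = 0 then create_insert D else create_increase D)"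
      by (simp add: entry_def)
    show "reg ?s 0 = n" by (rule configured_regs(1)[OF s(1)])
  qed (use s(4) r in simp_all)
qed auto

lemma run_entry_loop:
  assumes "configured s" "holds_matrix s"
  shows "run (entry_loop D) s (hist (inserts n \<union> pads n)) (n * (16 * n + 6) + 3)
    (\<lambda>s' S'. configured s' \<and> S' = hist matrix_slots)"
  unfolding entry_loop_def
proof (rule run_mono[OF run_for_loop[where
      I = "\<lambda>i s S. configured s \<and> holds_matrix s \<and> S = hist (inserts n \<union> pads n \<union> entries i)"
      and u = "16 * n + 3"]])
  fix i s S
  assume i: "i < n" and I: "configured s \<and> holds_matrix s \<and> S = hist (inserts n \<union> pads n \<union> entries i)"
    and r: "reg s 2 = i"
  let ?Y = "\<lambda>j. inserts n \<union> pads n \<union> entries i \<union> entry i ` {..<j}"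
  let ?I = "\<lambda>j s S. configured s \<and> holds_matrix s \<and> reg s 2 = i \<and> S = hist (?Y j)"
  have Yn: "?Y n = inserts n \<union> pads n \<union> entries (Suc i)" by (auto simp: entries_def less_Suc_eq)
  have Y0: "?Y 0 = inserts n \<union> pads n \<union> entries i" by simp
  show "run (for_loop 4 5 (entry_step D)) s S (16 * n + 3)
    (\<lambda>s' S'. (configured s' \<and> holds_matrix s' \<and> S' = hist (inserts n \<union> pads n \<union> entries (Suc i)))
      \<and> reg s' 2 = i)"
  proof (rule run_mono[OF run_for_loop[where I = ?I and u = 13]])
    fix j s S
    assume j: "j < n" and J: "?I j s S" and r': "reg s 4 = j"
    then have S: "S = hist (?Y j)" by simp
    show "run (entry_step D) s S 13 (\<lambda>s' S'. ?I (Suc j) s' S' \<and> reg s' 4 = j)"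
      unfolding S
      by (rule run_mono[OF run_entry_step[OF _ _ _ r' i j refl refl] order_refl]) (use J in auto)
  next
    show "?I 0 s S" unfolding Y0 using I r by simp
  next
    fix s' S'
    assume "?I n s' S'"
    then show "(configured s' \<and> holds_matrix s' \<and> S' = hist (inserts n \<union> pads n \<union> entries (Suc i)))
      \<and> reg s' 2 = i"
      unfolding Yn by simp
  qed (auto simp: configured_regs)
qed (use assms in \<open>auto simp: configured_regs entries_def matrix_slots_def\<close>)

lemma run_prepare:
  assumes "reg s 0 = n" "holds_matrix s"
  shows "run (prepare D \<beta>) s Map.empty (30 * (n + 1)\<^sup>2) (\<lambda>s' S'. configured s' \<and> S' = hist matrix_slots)"
  unfolding prepare_def
proof (rule run_straight)
  let ?cs = "[Const 1 1, Const 11 \<beta>, Calc Add 9 0 1, Calc Add 10 9 1]"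
  let ?u = "(7 * n + 3) + ((n * (14 * n + 6) + 3) + (n * (16 * n + 6) + 3))"
  have "n + 2 < 2 ^ w" "n + 1 < 2 ^ w" "\<beta> < 2 ^ w" using \<beta> by (auto intro!: small_word)
  then have s: "configured (fold (effect w) ?cs s)" "holds_matrix (fold (effect w) ?cs s)"
    using assms by (simp_all add: configured_def)
  show "run (Seq (insert_loop D) (Seq (pad_loop D) (entry_loop D))) (fold (effect w) ?cs s)
    Map.empty ?u (\<lambda>s' S'. configured s' \<and> S' = hist matrix_slots)"
    by (rule run_Seq, rule run_mono[OF run_insert_loop[OF s] order_refl], clarify,
      rule run_Seq, rule run_mono[OF run_pad_loop order_refl], assumption, assumption, clarify,
      rule run_entry_loop)
  \<comment> \<open>The left side is 30 * n^2 + 19 * n + 13; the leading coefficient adds 14 from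
    lifting the keys and 16 from the entries.\<close>
  show "length ?cs + ?u \<le> 30 * (n + 1)\<^sup>2"
    by (simp add: power2_eq_square algebra_simps)
qed simp

section \<open>Correctness of the answer to one vector\<close>

definition holds_vector :: "(nat \<Rightarrow> bool) \<Rightarrow> memory \<Rightarrow> bool" where
  "holds_vector v s \<longleftrightarrow> (\<forall>j<n. arr s 1 j = of_bool (v j))"

lemma holds_vector_set_reg [simp]: "holds_vector v (set_reg x u s) \<longleftrightarrow> holds_vector v s"
  and holds_vector_set_arr [simp]: "holds_vector v (set_arr 2 f s) \<longleftrightarrow> holds_vector v s"
  by (auto simp: holds_vector_def)

lemma slots_distinct: "(1, j) \<notin> matrix_slots"
  by (auto simp: slot_defs)

text \<open>\<open>Y j\<close> is the set of occupied slots after the first \<open>j\<close> keys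
  have been handled, growing or shrinking with \<open>j\<close>. The predicate \<open>P\<close> is
  carried along so that the cancelling pass keeps the answers already written to array 2.\<close>

lemma run_vector_loop:
  assumes "configured s" "holds_vector v s" "P s"
    and P: "\<And>x u s. P (set_reg x u s) \<longleftrightarrow> P s"
    and step: "\<And>j (s :: memory). j < n \<Longrightarrow> v j \<Longrightarrow> reg s 2 = j \<Longrightarrow> reg s 6 = time (1, j) \<Longrightarrow> reg s 0 = n \<Longrightarrow>
      run c s (hist (Y j)) 4 (\<lambda>s' S'. s' = s \<and> S' = hist (Y (Suc j)))"
    and skip: "\<And>j. j < n \<Longrightarrow> \<not> v j \<Longrightarrow> Y (Suc j) = Y j"
  shows "run (vector_loop c) s (hist (Y 0)) (10 * n + 3)
    (\<lambda>s' S'. configured s' \<and> holds_vector v s' \<and> P s' \<and> S' = hist (Y n))"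
  unfolding vector_loop_def
proof (rule run_for_loop[where I = "\<lambda>j s S. configured s \<and> holds_vector v s \<and> P s \<and> S = hist (Y j)"
      and u = 7])
  fix j s S
  assume j: "j < n" and I: "configured s \<and> holds_vector v s \<and> P s \<and> S = hist (Y j)" and r: "reg s 2 = j"
  let ?Q = "\<lambda>s' S'. (configured s' \<and> holds_vector v s' \<and> P s' \<and> S' = hist (Y (Suc j))) \<and> reg s' 2 = j"
  let ?s = "set_reg 6 (time (1, j)) (set_reg 7 (of_bool (v j)) s)"
  show "run (foldr Seq [Load 7 1 2, Calc Add 6 9 2] (If_nonzero 7 c Skip)) s S 7 ?Q"
  proof (rule run_straight)
    have "time (1, j) < 2 ^ w" using j by (intro slot_bounds) auto
    then have e: "fold (effect w) [Load 7 1 2, Calc Add 6 9 2] s = ?s"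
      using I r j by (simp add: configured_regs holds_vector_def time_def)
    have Q: "?Q ?s (hist (Y (Suc j)))" using I r by (simp add: P)
    have "run (If_nonzero 7 c Skip) ?s (hist (Y j)) (4 + 1) ?Q"
    proof (rule run_If)
      assume "reg ?s 7 \<noteq> 0"
      then have "run c ?s (hist (Y j)) 4 (\<lambda>s' S'. s' = ?s \<and> S' = hist (Y (Suc j)))"
        using j I r by (intro step) (auto simp: configured_regs)
      then show "run c ?s (hist (Y j)) 4 ?Q"
        by (rule run_mono) (use Q in auto)
    next
      assume "reg ?s 7 = 0"
      then have "Y (Suc j) = Y j" using j by (intro skip) auto
      then show "run Skip ?s (hist (Y j)) 4 ?Q" using Q by (intro run_Skip) auto
    qed simp
    then show "run (If_nonzero 7 c Skip) (fold (effect w) [Load 7 1 2, Calc Add 6 9 2] s) S 5 ?Q"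
      unfolding e using I by simp
  qed auto
qed (use assms(1-3) in \<open>auto simp: configured_regs P\<close>)

lemma run_query_loop:
  assumes "configured s" "holds_vector v s"
  shows "run (query_loop D) s (hist (matrix_slots \<union> vector_slots v UNIV)) (14 * n + 3)
    (\<lambda>s' S'. configured s' \<and> holds_vector v s' \<and> (\<forall>i<n. arr s' 2 i = of_bool (bool_mult_vec n M v i))
      \<and> S' = hist (matrix_slots \<union> vector_slots v UNIV))"
  unfolding query_loop_def
proof (rule run_for_loop[where u = 11 and I = "\<lambda>i s S. configured s \<and> holds_vector v s
      \<and> (\<forall>i'<i. arr s 2 i' = of_bool (bool_mult_vec n M v i'))
      \<and> S = hist (matrix_slots \<union> vector_slots v UNIV)"])
  fix i s S
  let ?Y = "matrix_slots \<union> vector_slots v UNIV"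
  let ?I = "\<lambda>i s S. configured s \<and> holds_vector v s
      \<and> (\<forall>i'<i. arr s 2 i' = of_bool (bool_mult_vec n M v i')) \<and> S = hist ?Y"
  assume i: "i < n" and I: "?I i s S" and r: "reg s 2 = i"
  let ?Q = "\<lambda>s' S'. ?I (Suc i) s' S' \<and> reg s' 2 = i"
  let ?q = "n + 2 + 2 * i"
  let ?m = "Max (value_at ?Y ?q ` {..<n})"
  let ?cs = "[Calc Add 7 2 2, Calc Add 7 7 10] @ place 0"
  let ?s = "set_reg 6 (time (?q, n)) (set_reg 7 ?q s)"
  show "run (foldr Seq ?cs
       (Seq (ask (query D) 6 7) (foldr Seq [Calc Add 8 2 10, Calc Equal 7 7 8] (Store 2 2 7))))
     s S 11 ?Q"
  proof (rule run_straight)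
    have q: "?q \<le> 3 * n + 2" using i by simp
    have bounds: "time (?q, n) < 2 ^ w" "?q < 2 ^ w" "n + 2 + i < 2 ^ w"
      using slot_bounds[OF q, of n] q i by (auto intro!: small_word)
    have "i + i < 2 ^ w" using i by (intro small_word) simp
    then have f: "fold (effect w) [Calc Add 7 2 2, Calc Add 7 7 10] s = set_reg 7 ?q s"
      using I r bounds(2) by (simp add: configured_regs mult_2_right ac_simps)
    have "fold (effect w) (place 0) (set_reg 7 ?q s) = ?s"
      by (rule fold_place) (use I bounds(1) in \<open>simp_all add: configured_regs\<close>)
    then have e: "fold (effect w) ?cs s = ?s" unfolding fold_append comp_apply f .
    have s: "configured ?s" "holds_vector v ?s" "reg ?s 2 = i" "arr ?s = arr s"
      using I r by simp_all
    have m: "?m \<le> n + 2 + i" by (rule find_max_query(2)[OF i])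
    have "run (ask (query D) 6 7) ?s (hist ?Y) 4
      (\<lambda>s' S'. run (foldr Seq [Calc Add 8 2 10, Calc Equal 7 7 8] (Store 2 2 7)) s' S' 3 ?Q)"
    proof (rule run_ask_slot[where q = ?q and v = ?m])
      show "slots ?Y" by (rule slots_matrix)
      show "\<forall>j<n. (0, j) \<in> ?Y" by (auto simp: slot_defs)
      show "?m < 2 ^ w" using m bounds(3) by linarith
      let ?s' = "set_reg 7 (of_bool (bool_mult_vec n M v i)) (set_reg 8 (n + 2 + i) (set_reg 7 ?m ?s))"
      have e': "fold (effect w) [Calc Add 8 2 10, Calc Equal 7 7 8] (set_reg 7 ?m ?s) = ?s'"
        using s(1,3) bounds(3) find_max_query(1)[OF i, of v] by (simp add: configured_regs ac_simps)
      have "run (Store 2 2 7) ?s' (hist ?Y) 1 ?Q"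
        by (rule run_own) (use s I in \<open>auto simp: less_Suc_eq\<close>)
      then show "run (foldr Seq [Calc Add 8 2 10, Calc Equal 7 7 8] (Store 2 2 7))
        (set_reg 7 ?m ?s) (hist ?Y) 3 ?Q"
        unfolding e'[symmetric] by (intro run_straight[where u = 1]) auto
    qed (use q s in \<open>simp_all add: configured_regs\<close>)
    from run_Seq[OF this] show "run (Seq (ask (query D) 6 7)
        (foldr Seq [Calc Add 8 2 10, Calc Equal 7 7 8] (Store 2 2 7))) (fold (effect w) ?cs s) S 7 ?Q"
      unfolding e using I by simp
  qed auto
qed (use assms in \<open>auto simp: configured_regs\<close>)

text \<open>Creation moves through \<open>K = {..<j}\<close> from nothing to the full vector,
  cancellation through \<open>K = {j..}\<close> back to nothing. The history is the same afterwards
  as before, which makes the program repeatable.\<close>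

lemma run_answer:
  assumes "configured s" "holds_vector v s"
  shows "run (answer D) s (hist matrix_slots) (34 * (n + 1))
    (\<lambda>s' S'. configured s' \<and> (\<forall>i<n. arr s' 2 i = of_bool (bool_mult_vec n M v i))
      \<and> S' = hist matrix_slots)"
proof -
  let ?Y = "\<lambda>K. matrix_slots \<union> vector_slots v K"
  let ?P = "\<lambda>s. \<forall>i<n. arr s 2 i = of_bool (bool_mult_vec n M v i)"
  have "run (vector_loop (create (create_increase D) 6 2)) s (hist (?Y {..<0})) (10 * n + 3)
    (\<lambda>s' S'. configured s' \<and> holds_vector v s' \<and> True \<and> S' = hist (?Y {..<n}))"
  proof (rule run_vector_loop[where Y = "\<lambda>j. ?Y {..<j}"])
    fix j and s :: memory
    assume j: "j < n" "v j" "reg s 2 = j" "reg s 6 = time (1, j)" "reg s 0 = n"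
    have eq: "?Y {..<Suc j} = insert (1, j) (?Y {..<j})"
      using j by (auto simp: vector_slots_def less_Suc_eq)
    show "run (create (create_increase D) 6 2) s (hist (?Y {..<j})) 4
      (\<lambda>s' S'. s' = s \<and> S' = hist (?Y {..<Suc j}))"
    proof (rule run_create_slot[where r = 1 and j = j])
      show "slots (insert (1, j) (?Y {..<j}))" unfolding eq[symmetric] by (rule slots_matrix)
      show "(1, j) \<notin> ?Y {..<j}" using slots_distinct by (auto simp: vector_slots_def)
    qed (use j eq slots_matrix in auto)
  qed (use assms in \<open>auto simp: vector_slots_def less_Suc_eq\<close>)
  moreover have "?Y {..<0} = matrix_slots" "?Y {..<n} = ?Y UNIV" by (auto simp: vector_slots_def)
  ultimately have 1: "run (vector_loop (create (create_increase D) 6 2)) s (hist matrix_slots) (10 * n + 3)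
    (\<lambda>s' S'. configured s' \<and> holds_vector v s' \<and> S' = hist (?Y UNIV))" by simp
  have 3: "run (vector_loop (call (cancel D) 6)) s (hist (?Y UNIV)) (10 * n + 3)
    (\<lambda>s' S'. configured s' \<and> ?P s' \<and> S' = hist matrix_slots)"
    if "configured s" "holds_vector v s" "?P s" for s
  proof -
    have "run (vector_loop (call (cancel D) 6)) s (hist (?Y {0..})) (10 * n + 3)
      (\<lambda>s' S'. configured s' \<and> holds_vector v s' \<and> ?P s' \<and> S' = hist (?Y {n..}))"
    proof (rule run_vector_loop[where Y = "\<lambda>j. ?Y {j..}"])
      fix j and s :: memory
      assume j: "j < n" "v j" "reg s 2 = j" "reg s 6 = time (1, j)" "reg s 0 = n"
      have eq: "?Y {Suc j..} = ?Y {j..} - {(1, j)}"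
        using j slots_distinct by (auto simp: vector_slots_def Suc_le_eq)
      show "run (call (cancel D) 6) s (hist (?Y {j..})) 4
        (\<lambda>s' S'. s' = s \<and> S' = hist (?Y {Suc j..}))"
      proof (rule run_cancel_slot[where r = 1 and j = j])
        show "slots (?Y {j..} - {(1, j)})" unfolding eq[symmetric] by (rule slots_matrix)
        show "(1, j) \<in> ?Y {j..}" using j by (auto simp: vector_slots_def)
      qed (use j eq slots_matrix in auto)
    next
      fix j
      assume j: "j < n" "\<not> v j"
      have "k \<in> {Suc j..} \<and> v k \<longleftrightarrow> k \<in> {j..} \<and> v k" for k
        using j(2) by (cases "k = j") auto
      then show "?Y {Suc j..} = ?Y {j..}" by (simp add: vector_slots_def)
    qed (use that in auto)
    moreover have "?Y {0..} = ?Y UNIV" "?Y {n..} = matrix_slots" by (auto simp: vector_slots_def)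
    ultimately have "run (vector_loop (call (cancel D) 6)) s (hist (?Y UNIV)) (10 * n + 3)
      (\<lambda>s' S'. configured s' \<and> holds_vector v s' \<and> ?P s' \<and> S' = hist matrix_slots)"
      by (simp only:)
    then show ?thesis by (rule run_mono) simp_all
  qed
  have "run (answer D) s (hist matrix_slots) ((10 * n + 3) + ((14 * n + 3) + (10 * n + 3)))
    (\<lambda>s' S'. configured s' \<and> ?P s' \<and> S' = hist matrix_slots)"
    unfolding answer_def
    by (rule run_Seq, rule run_mono[OF 1 order_refl], clarify,
      rule run_Seq, rule run_mono[OF run_query_loop order_refl], assumption, assumption, clarify,
      rule 3)
  then show ?thesis by (rule run_mono) simp_all
qed

text \<open>Between two vectors the history is always \<open>hist matrix_slots\<close>, so each
  vector merely uses up 34 * (n + 1) of the available operations and the corresponding time.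
  Revealing a vector touches array 1 only and leaves the memory of the queue alone.\<close>

lemma omv_answers_answer:
  assumes "configured s" "ready (hist matrix_slots) m (length vs * (34 * (n + 1)))"
    and "length vs * (34 * (n + 1)) * (b + 1) \<le> t"
  shows "omv_answers (answer D) w n M vs (join s m) t"
  using assms
proof (induction vs arbitrary: s m t)
  case (Cons v vs)
  let ?u = "34 * (n + 1)"
  have "configured (reveal n v s)" "holds_vector v (reveal n v s)"
    using Cons.prems(1) by (auto simp: configured_def holds_vector_def reveal_def)
  note run = run_answer[OF this]
  have "ready (hist matrix_slots) m (length vs * ?u + ?u)"
    using Cons.prems(2) by (simp add: ac_simps)
  from runE[OF run this] obtain k s' m' S' where *:
    "exec w (answer D) (join (reveal n v s) m) k (join s' m')" "k \<le> ?u * (b + 1)"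
    "configured s' \<and> (\<forall>i<n. arr s' 2 i = of_bool (bool_mult_vec n M v i)) \<and> S' = hist matrix_slots"
    "ready S' m' (length vs * ?u)" .
  have "length vs * ?u * (b + 1) + ?u * (b + 1) \<le> t"
    using Cons.prems(3) by (simp add: algebra_simps)
  then have "length vs * ?u * (b + 1) \<le> t - k" "k \<le> t" using *(2) by linarith+
  then have "omv_answers (answer D) w n M vs (join s' m') (t - k)"
    using *(3,4) by (intro Cons.IH) auto
  with *(1,3) \<open>k \<le> t\<close> show ?case
    by (auto simp: reveal_join intro!: exI[of _ k] exI[of _ "join s' m'"])
qed simp

text \<open>The constant 64 is 30 for the preparation plus 34 for the answers to all
  \<open>n\<close> vectors; the last 1 in \<open>t\<close> is the test of the guard.\<close>

lemma solves_instance: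
  assumes ready: "ready Map.empty zero_memory (64 * (n + 1)\<^sup>2)" and vs: "length vs = n"
    and t: "t = 64 * (n + 1)\<^sup>2 * (b + 1) + 1"
  shows "\<exists>k s. exec w (If_nonzero 0 (prepare D \<beta>) Skip) (omv_start n M) k s \<and> k \<le> t
    \<and> omv_answers (answer D) w n M vs s (t - k)"
proof -
  let ?s = "omv_start n M"
  have "holds_matrix ?s"
    unfolding holds_matrix_def
  proof (intro allI impI)
    fix i j
    assume ij: "i < n" "j < n"
    then have "i * n + j < n * n" using mult_le_mono1[of "Suc i" n n] by simp
    with ij show "arr ?s 0 (i * n + j) = of_bool (M i j)"
      by (simp add: omv_start_def)
  qed
  moreover have "reg ?s 0 = n" by (simp add: omv_start_def)
  ultimately have run: "run (prepare D \<beta>) ?s Map.empty (30 * (n + 1)\<^sup>2)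
    (\<lambda>s' S'. configured s' \<and> S' = hist matrix_slots)" by (intro run_prepare)
  have "ready Map.empty zero_memory (34 * (n + 1)\<^sup>2 + 30 * (n + 1)\<^sup>2)"
    using ready by simp
  from runE[OF run this] obtain k s' m' S' where *:
    "exec w (prepare D \<beta>) (join ?s zero_memory) k (join s' m')" "k \<le> 30 * (n + 1)\<^sup>2 * (b + 1)"
    "configured s' \<and> S' = hist matrix_slots" "ready S' m' (34 * (n + 1)\<^sup>2)" .
  have le: "n * (34 * (n + 1)) \<le> 34 * (n + 1)\<^sup>2" by (simp add: power2_eq_square algebra_simps)
  have "34 * (n + 1)\<^sup>2 * (b + 1) + (k + 1) \<le> t"
    using *(2) unfolding t by (simp add: algebra_simps)
  moreover have "n * (34 * (n + 1)) * (b + 1) \<le> 34 * (n + 1)\<^sup>2 * (b + 1)"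
    using le by (rule mult_le_mono1)
  ultimately have "k + 1 \<le> t" and "n * (34 * (n + 1)) * (b + 1) \<le> t - (k + 1)" by linarith+
  moreover have "ready (hist matrix_slots) m' (n * (34 * (n + 1)))"
    using *(3) ready_mono[OF *(4) le] by simp
  ultimately have "omv_answers (answer D) w n M vs (join s' m') (t - (k + 1))"
    using *(3) vs by (intro omv_answers_answer) (simp_all only:)
  moreover have "exec w (If_nonzero 0 (prepare D \<beta>) Skip) ?s (k + 1) (join s' m')"
    using *(1) n_pos \<open>reg ?s 0 = n\<close> omv_start_join[of n M] by (intro exec_If_true) simp_all
  ultimately show ?thesis using \<open>k + 1 \<le> t\<close> by blast
qed

end

section \<open>Choice of the parameters and the total running time\<close>

lemma word_length_bound:
  assumes "8 < c"
  shows "16 * (n + 1)\<^sup>2 \<le> 2 ^ word_length c n"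
proof -
  let ?W = "2 ^ (floor_log n + 1) :: nat"
  have W: "n + 1 \<le> ?W" using floor_log_exp2_gt[of n] by simp
  \<comment> \<open>The factor 16 is absorbed by \<open>?W ^ 4\<close> because \<open>?W\<close> is
    at least 2, and two further powers cover (n + 1)^2; six powers in total, fewer than
    \<open>c\<close>.\<close>
  have "2 ^ 4 * (n + 1)\<^sup>2 \<le> ?W ^ 4 * ?W\<^sup>2"
    using W by (intro mult_le_mono power_mono) auto
  also have "\<dots> = ?W ^ 6" by (simp add: power_add[symmetric])
  also have "\<dots> \<le> ?W ^ c" using assms by (intro power_increasing) auto
  also have "\<dots> = 2 ^ word_length c n" by (simp only: word_length_def power_mult[symmetric] mult.commute)
  finally show ?thesis by simp
qed

lemma fully_retroactive_queue_solves_omv: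
  assumes iv: "iv = (\<lambda>k. \<beta> * k)" "\<beta> \<le> 1" and "8 < c"
    and D: "\<And>n xs. legal iv n Map.empty xs \<Longrightarrow> length xs \<le> (n + 1) ^ 8 \<Longrightarrow>
      \<forall>x\<in>set xs. operation_below ((n + 1) ^ 8) x \<Longrightarrow>
      serves iv D (word_length c n) n (T n) Map.empty zero_memory xs"
  shows "solves_omv (If_nonzero 0 (prepare D \<beta>) Skip) (answer D) c
    (\<lambda>n. 64 * (n + 1)\<^sup>2 * (T n + 1) + 1)"
  unfolding solves_omv_def
proof (intro allI impI)
  fix n :: nat and M :: "nat \<Rightarrow> nat \<Rightarrow> bool" and vs :: "(nat \<Rightarrow> bool) list"
  assume vs: "length vs = n"
  let ?t = "64 * (n + 1)\<^sup>2 * (T n + 1) + 1"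
  show "\<exists>k s. exec (word_length c n) (If_nonzero 0 (prepare D \<beta>) Skip) (omv_start n M) k s
    \<and> k \<le> ?t \<and> omv_answers (answer D) (word_length c n) n M vs s (?t - k)"
  proof (cases "n = 0")
    case True
    have "exec (word_length c n) (If_nonzero 0 (prepare D \<beta>) Skip) (omv_start n M) (1 + 1)
      (omv_start n M)"
      using True by (intro exec_If_false exec_Skip) (simp add: omv_start_def)
    moreover have "1 + 1 \<le> ?t" using True by simp
    moreover have "omv_answers (answer D) (word_length c n) n M vs (omv_start n M) (?t - (1 + 1))"
      using True vs by simp
    ultimately show ?thesis by blast
  next
    case False
    \<comment> \<open>The origin of the exponent 8: for positive \<open>n\<close> the constant 64 is
      at most (n + 1)^6, so (n + 1)^8 bounds both the number of operations and the times.\<close>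
    have "2 ^ 6 * (n + 1)\<^sup>2 \<le> (n + 1) ^ 6 * (n + 1)\<^sup>2"
      using False by (intro mult_le_mono1 power_mono) auto
    also have "\<dots> = (n + 1) ^ 8" by (simp only: power_add[symmetric]) simp
    finally have le: "64 * (n + 1)\<^sup>2 \<le> (n + 1) ^ 8" by simp
    interpret omv_reduction iv D "word_length c n" n "T n" "(n + 1) ^ 8" \<beta> M
    proof
      show "4 * (n + 1)\<^sup>2 \<le> (n + 1) ^ 8" using le by linarith
    qed (use False iv word_length_bound[OF \<open>8 < c\<close>] in simp_all)
    have "ready Map.empty zero_memory (64 * (n + 1)\<^sup>2)"
      unfolding ready_def using D le by (meson le_trans)
    from solves_instance[OF this vs refl] show ?thesis .
  qed
qed

text \<open>The product of n^2 and n^(1 - \<delta>) gives the exponent. The condition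
  \<open>\<delta> \<le> 1\<close> keeps n^(1 - \<delta>) at least 1 for positive \<open>n\<close>,
  so that it absorbs the 1 added to \<open>T n\<close>.\<close>

lemma reduction_time_bigo:
  fixes T :: "nat \<Rightarrow> nat" and \<delta> :: real
  assumes T: "(\<lambda>n. real (T n)) \<in> O(\<lambda>n. real n powr (1 - \<delta>))" and "\<delta> \<le> 1"
  shows "(\<lambda>n. real (64 * (n + 1)\<^sup>2 * (T n + 1) + 1)) \<in> O(\<lambda>n. real n powr (3 - \<delta>))"
proof -
  have "(\<lambda>n. 64 * (real n + 1)\<^sup>2) \<in> O(\<lambda>n. real n powr 2)"
  proof (rule bigoI)
    show "\<forall>\<^sub>F n in sequentially. norm (64 * (real n + 1)\<^sup>2) \<le> 256 * norm (real n powr 2)"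
      using eventually_gt_at_top[of 0]
    proof eventually_elim
      case (elim n)
      then have "(real n + 1)\<^sup>2 \<le> (2 * real n)\<^sup>2" by (intro power_mono) auto
      with elim show ?case by (simp add: powr_numeral power_mult_distrib)
    qed
  qed
  moreover have one: "(\<lambda>n. 1) \<in> O(\<lambda>n. real n powr a)" if "0 \<le> a" for a
  proof (rule bigoI)
    show "\<forall>\<^sub>F n in sequentially. norm (1 :: real) \<le> 1 * norm (real n powr a)"
      using eventually_gt_at_top[of 0]
      by eventually_elim (use that in \<open>simp add: ge_one_powr_ge_zero\<close>)
  qed
  have "(\<lambda>n. real (T n) + 1) \<in> O(\<lambda>n. real n powr (1 - \<delta>))"
    using \<open>\<delta> \<le> 1\<close> by (intro sum_in_bigo T one) simp
  ultimately have "(\<lambda>n. 64 * (real n + 1)\<^sup>2 * (real (T n) + 1)) \<in>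
      O(\<lambda>n. real n powr 2 * real n powr (1 - \<delta>))"
    by (rule landau_o.big.mult)
  then have "(\<lambda>n. 64 * (real n + 1)\<^sup>2 * (real (T n) + 1)) \<in> O(\<lambda>n. real n powr (3 - \<delta>))"
    by (simp only: powr_add[symmetric]) (simp add: algebra_simps)
  moreover have "(\<lambda>n. 1) \<in> O(\<lambda>n. real n powr (3 - \<delta>))"
    using \<open>\<delta> \<le> 1\<close> by (intro one) simp
  ultimately have "(\<lambda>n. 64 * (real n + 1)\<^sup>2 * (real (T n) + 1) + 1) \<in> O(\<lambda>n. real n powr (3 - \<delta>))"
    by (rule sum_in_bigo)
  then show ?thesis by (simp add: algebra_simps)
qed

theorem theorem10:
  fixes \<epsilon> :: real and iv :: "nat \<Rightarrow> nat"
  assumes "OMv_conjecture"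
    and "\<epsilon> > 0"
    and "iv = (\<lambda>k. 0) \<or> iv = (\<lambda>k. k)"
  shows "\<not> (\<exists>D. fully_retroactive_queue iv D (\<lambda>n. real n powr (1 - \<epsilon>)))"
proof
  assume "\<exists>D. fully_retroactive_queue iv D (\<lambda>n. real n powr (1 - \<epsilon>))"
  then obtain D where "fully_retroactive_queue iv D (\<lambda>n. real n powr (1 - \<epsilon>))" ..
  then obtain c T where "8 < c" and T: "(\<lambda>n. real (T n)) \<in> O(\<lambda>n. real n powr (1 - \<epsilon>))"
    and D: "\<And>n xs. legal iv n Map.empty xs \<Longrightarrow> length xs \<le> (n + 1) ^ 8 \<Longrightarrow>
      \<forall>x\<in>set xs. operation_below ((n + 1) ^ 8) x \<Longrightarrow>
      serves iv D (word_length c n) n (T n) Map.empty zero_memory xs"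
    unfolding fully_retroactive_queue_def by blast
  obtain \<beta> :: nat where \<beta>: "iv = (\<lambda>k. \<beta> * k)" "\<beta> \<le> 1"
    using assms(3)
  proof
    assume "iv = (\<lambda>k. 0)"
    then show thesis by (intro that[of 0]) simp_all
  next
    assume "iv = (\<lambda>k. k)"
    then show thesis by (intro that[of 1]) simp_all
  qed
  \<comment> \<open>For \<open>\<epsilon>\<close> above 1 the assumed bound tends to 0 and would not
    absorb the constant overhead per operation. Weakening it to exponent 0 loses nothing, as a
    contradiction with the conjecture at \<open>\<delta>\<close> suffices.\<close>
  define \<delta> where "\<delta> = min \<epsilon> 1"
  have "\<forall>\<^sub>F n in sequentially. norm (real n powr (1 - \<epsilon>)) \<le> 1 * norm (real n powr (1 - \<delta>))"
    using eventually_gt_at_top[of 0]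
    by eventually_elim (simp add: \<delta>_def powr_mono)
  then have "(\<lambda>n. real n powr (1 - \<epsilon>)) \<in> O(\<lambda>n. real n powr (1 - \<delta>))"
    by (rule bigoI)
  with T have "(\<lambda>n. real (T n)) \<in> O(\<lambda>n. real n powr (1 - \<delta>))"
    by (rule landau_o.big_trans)
  then have "(\<lambda>n. real (64 * (n + 1)\<^sup>2 * (T n + 1) + 1)) \<in> O(\<lambda>n. real n powr (3 - \<delta>))"
    by (rule reduction_time_bigo) (simp add: \<delta>_def)
  moreover have "0 < \<delta>" "2 \<le> c" using \<open>\<epsilon> > 0\<close> \<open>8 < c\<close> by (simp_all add: \<delta>_def)
  ultimately show False
    using assms(1) fully_retroactive_queue_solves_omv[OF \<beta> \<open>8 < c\<close> D]
    unfolding OMv_conjecture_def by blast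
qed

end
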